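(* Let $M$ be an odd Poisson supermanifold. The odd Laplace operator on half-densities is constant on the orbits of the master groupoid of $M$. That is, if $\boldsymbol{\rho}$ and $\boldsymbol{\rho}'$ are non-degenerate volume forms in the same orbit of the master groupoid, then the operators $\boldsymbol{s}\mapsto\boldsymbol{\rho}^{1/2}\Delta_{\boldsymbol{\rho}}(\boldsymbol{s}\boldsymbol{\rho}^{-1/2})$ and $\boldsymbol{s}\mapsto\boldsymbol{\rho}'^{1/2}\Delta_{\boldsymbol{\rho}'}(\boldsymbol{s}\boldsymbol{\rho}'^{-1/2})$ on half-densities $\boldsymbol{s}$ coincide.
   Context: Setting. $M$ is a smooth supermanifold with local coordinates $x^a$ of parity $\tilde a$; tilde denotes parity; derivatives are left derivatives. An odd Poisson (Schouten) structure on $M$ is an odd function $\mathfrak{S}=\frac12\mathfrak{S}^{ab}(x)p_bp_a$ on $T^*M$, quadratic in the momenta, with $\mathfrak{S}^{ab}=(-1)^{\tilde a\tilde b}\mathfrak{S}^{ba}$ of parity $\tilde a+\tilde b+1$, satisfying $(\mathfrak{S},\mathfrak{S})=0$ for the canonical even Poisson bracket $(\ ,\ )$ on $T^*M$. The odd bracket is $\{f,g\}=(f,(\mathfrak{S},g))=-(-1)^{\tilde f(\tilde a+1)}\mathfrak{S}^{ab}\frac{\partial f}{\partial x^b}\frac{\partial g}{\partial x^a}$; the condition $(\mathfrak{S},\mathfrak{S})=0$ is equivalent to its graded Jacobi identity. A supermanifold with such a structure is an odd Poisson (= Schouten) manifold. Hamiltonian vector field: $X_f:=(-1)^{\tilde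 f+1}\{f,\ \}=(-1)^{\tilde a\tilde f}\mathfrak{S}^{ab}\frac{\partial f}{\partial x^b}\frac{\partial}{\partial x^a}$, of parity $\tilde f+1$. A volume form is locally $\boldsymbol{\rho}=\rho\,Dx$, where $Dx$ is the Berezin coordinate volume element (transforming by the Berezinian); non-degenerate means it is a basis element of the module of volume forms ($\rho$ even and invertible). Standing convention: $M$ is oriented and coefficients $\rho$ are positive, so that real powers make sense. The divergence is $\mathrm{div}_{\boldsymbol{\rho}}X=\frac1\rho(-1)^{\tilde a(\tilde X+1)}\frac{\partial(\rho X^a)}{\partial x^a}$. The odd Laplace operator on functions is $\Delta_{\boldsymbol{\rho}}f:=\mathrm{div}_{\boldsymbol{\rho}}X_f=\frac1\rho\frac{\partial}{\partial x^a}\left(\rho\,\mathfrak{S}^{ab}\frac{\partial f}{\partial x^b}\right)$. Half-densities are densities of weight $1/2$, locally $s(x)(Dx)^{1/2}$; given a non-degenerate $\boldsymbol{\rho}$, they all have the form $\boldsymbol{s}=s\boldsymbol{\rho}^{1/2}$ with $s$ a function, and $\boldsymbol{s}\boldsymbol{\rho}^{-1/2}=s$. The odd Laplace operator on half-densities defined by $\boldsymbol{\rho}$ is $\Delta(\boldsymbol{s}):=\boldsymbol{\rho}^{1/2}\Delta_{\boldsymbol{\rho}}(\boldsymbol{s}\boldsymbol{\rho}^{-1/2})$. Master groupoid: its objects are the non-degenerate volume forms on $M$; its arrows $\boldsymbol{\rho}\to\boldsymbol{\rho}'$ are the factors $e^{\sigma}$, $\sigma$ an even function, with $\boldsymbol{\rho}'=e^{\sigma}\boldsymbol{\rho}$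 and $\Delta_{\boldsymbol{\rho}}e^{\sigma/2}=0$; composition is multiplication. (These arrows are closed under composition and inverses.) Two volume forms are in the same orbit if there is an arrow between them. *)

theory Defs
  imports "HOL-Analysis.Analysis"
begin

section \<open>The Grassmann algebra\<close>

text \<open>
  Elements of the real Grassmann algebra with generators \<open>\<theta>\<^sub>0, \<theta>\<^sub>1, \<dots>\<close> are families of coefficients
  indexed by finite sets \<open>I\<close> of generators; the coefficient of \<open>I = {i\<^sub>1 < \<dots> < i\<^sub>k}\<close> belongs to the
  monomial \<open>\<theta>\<^bsub>i\<^sub>1\<^esub> \<cdots> \<theta>\<^bsub>i\<^sub>k\<^esub>\<close>.  Formal infinite sums of monomials are admitted in the type, so that
  all operations are total; values of superfunctions of odd dimension \<open>m\<close> only involve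
  \<open>\<theta>\<^sub>0, \<dots>, \<theta>\<^bsub>m-1\<^esub>\<close>.
\<close>

typedef grassmann = "{c :: nat set \<Rightarrow> real. \<forall>I. infinite I \<longrightarrow> c I = 0}"
  morphisms coeff Grassmann
  by (rule exI[of _ "\<lambda>_. 0"]) simp

setup_lifting type_definition_grassmann

lemma coeff_infinite [simp]: "infinite I \<Longrightarrow> coeff z I = 0"
  using coeff[of z] by auto

lemma grassmann_eqI: "(\<And>I. finite I \<Longrightarrow> coeff y I = coeff z I) \<Longrightarrow> y = z"
  by (metis coeff_infinite coeff_inject ext)

text \<open>The sign in \<open>\<theta>\<^sub>I \<theta>\<^sub>J = \<plusminus>\<theta>\<^bsub>I \<union> J\<^esub>\<close> for disjoint \<open>I\<close> and \<open>J\<close>.\<close>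

definition gsign :: "nat set \<Rightarrow> nat set \<Rightarrow> real" where
  "gsign I J = (-1) ^ card {(i, j) \<in> I \<times> J. j < i}"

lemma gsign_empty [simp]: "gsign I {} = 1" "gsign {} I = 1"
  by (simp_all add: gsign_def)

instantiation grassmann :: real_algebra_1
begin

lift_definition zero_grassmann :: grassmann is "\<lambda>_. 0" by simp
lift_definition one_grassmann :: grassmann is "\<lambda>I. if I = {} then 1 else 0" by auto
lift_definition plus_grassmann :: "grassmann \<Rightarrow> grassmann \<Rightarrow> grassmann" is "\<lambda>a b I. a I + b I" by simp
lift_definition minus_grassmann :: "grassmann \<Rightarrow> grassmann \<Rightarrow> grassmann" is "\<lambda>a b I. a I - b I" by simp
lift_definition uminus_grassmann :: "grassmann \<Rightarrow> grassmann" is "\<lambda>a I. - a I" by simp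
lift_definition scaleR_grassmann :: "real \<Rightarrow> grassmann \<Rightarrow> grassmann" is "\<lambda>r a I. r * a I" by simp
lift_definition times_grassmann :: "grassmann \<Rightarrow> grassmann \<Rightarrow> grassmann" is
  "\<lambda>a b K. \<Sum>I\<in>Pow K. gsign I (K - I) * a I * b (K - I)" by simp

instance
proof
  fix a b c :: grassmann and r s :: real
  show "a + b + c = a + (b + c)" "a + b = b + a" "0 + a = a" "- a + a = 0" "a - b = a + - b"
    by (transfer; simp add: algebra_simps)+
  show "r *\<^sub>R (a + b) = r *\<^sub>R a + r *\<^sub>R b" "(r + s) *\<^sub>R a = r *\<^sub>R a + s *\<^sub>R a"
    "r *\<^sub>R s *\<^sub>R a = (r * s) *\<^sub>R a" "1 *\<^sub>R a = a"
    by (transfer; simp add: algebra_simps)+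
  show "(a + b) * c = a * c + b * c" "a * (b + c) = a * b + a * c"
    by (transfer; simp add: algebra_simps sum.distrib)+
  show "r *\<^sub>R a * b = r *\<^sub>R (a * b)" "a * r *\<^sub>R b = r *\<^sub>R (a * b)"
    by (transfer; simp add: algebra_simps sum_distrib_left)+
  show "(0 :: grassmann) \<noteq> 1"
    by transfer (metis zero_neq_one)
  show "1 * a = a"
  proof (rule grassmann_eqI)
    fix K :: "nat set" assume K: "finite K"
    have "coeff (1 * a) K = (\<Sum>I\<in>Pow K. if I = {} then coeff a K else 0)"
      unfolding times_grassmann.rep_eq one_grassmann.rep_eq
      by (rule sum.cong) auto
    then show "coeff (1 * a) K = coeff a K" using K by (simp add: sum.delta')
  qed
  show "a * 1 = a"
  proof (rule grassmann_eqI)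
    fix K :: "nat set" assume K: "finite K"
    have "coeff (a * 1) K = (\<Sum>I\<in>Pow K. if I = K then coeff a K else 0)"
      unfolding times_grassmann.rep_eq one_grassmann.rep_eq
      by (rule sum.cong) auto
    then show "coeff (a * 1) K = coeff a K" using K by (simp add: sum.delta')
  qed
  show "a * b * c = a * (b * c)"
  proof (rule grassmann_eqI)
    fix K :: "nat set" assume K: "finite K"
    have add1: "gsign (I \<union> J) L = gsign I L * gsign J L"
      if "finite I" "finite J" "finite L" "I \<inter> J = {}" for I J L :: "nat set"
    proof -
      have "{(i, j) \<in> (I \<union> J) \<times> L. j < i} = {(i, j) \<in> I \<times> L. j < i} \<union> {(i, j) \<in> J \<times> L. j < i}"
        by auto
      moreover have "finite {(i, j) \<in> I \<times> L. j < i}" "finite {(i, j) \<in> J \<times> L. j < i}"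
        using that by (auto intro: finite_subset[of _ "I \<times> L"] finite_subset[of _ "J \<times> L"])
      ultimately have "card {(i, j) \<in> (I \<union> J) \<times> L. j < i}
          = card {(i, j) \<in> I \<times> L. j < i} + card {(i, j) \<in> J \<times> L. j < i}"
        using that by (simp, subst card_Un_disjoint) auto
      then show ?thesis by (simp add: gsign_def power_add)
    qed
    have add2: "gsign L (I \<union> J) = gsign L I * gsign L J"
      if "finite I" "finite J" "finite L" "I \<inter> J = {}" for I J L :: "nat set"
    proof -
      have "{(i, j) \<in> L \<times> (I \<union> J). j < i} = {(i, j) \<in> L \<times> I. j < i} \<union> {(i, j) \<in> L \<times> J. j < i}"
        by auto
      moreover have "finite {(i, j) \<in> L \<times> I. j < i}" "finite {(i, j) \<in> L \<times> J. j < i}"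
        using that by (auto intro: finite_subset[of _ "L \<times> I"] finite_subset[of _ "L \<times> J"])
      ultimately have "card {(i, j) \<in> L \<times> (I \<union> J). j < i}
          = card {(i, j) \<in> L \<times> I. j < i} + card {(i, j) \<in> L \<times> J. j < i}"
        using that by (simp, subst card_Un_disjoint) auto
      then show ?thesis by (simp add: gsign_def power_add)
    qed
    have finS: "I \<subseteq> K \<Longrightarrow> finite I" for I using K finite_subset by blast
    have "coeff (a * b * c) K = (\<Sum>L\<in>Pow K. \<Sum>I\<in>Pow L. gsign L (K - L) * gsign I (L - I) *
        coeff a I * coeff b (L - I) * coeff c (K - L))"
      by (simp add: times_grassmann.rep_eq sum_distrib_left sum_distrib_right mult_ac)
    also have "\<dots> = (\<Sum>(L, I)\<in>(SIGMA L:Pow K. Pow L). gsign L (K - L) * gsign I (L - I) *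
        coeff a I * coeff b (L - I) * coeff c (K - L))"
      using K finS by (subst sum.Sigma) auto
    also have "\<dots> = (\<Sum>(I, J)\<in>(SIGMA I:Pow K. Pow (K - I)). gsign I (K - I) * gsign J (K - I - J) *
        coeff a I * coeff b J * coeff c (K - I - J))"
    proof (rule sum.reindex_bij_witness[of _ "\<lambda>(I, J). (I \<union> J, I)" "\<lambda>(L, I). (I, L - I)"])
      fix p assume p: "p \<in> (SIGMA L:Pow K. Pow L)"
      obtain L I where LI: "p = (L, I)" "L \<subseteq> K" "I \<subseteq> L" using p by auto
      have e: "K - I = (L - I) \<union> (K - L)" "K - I - (L - I) = K - L" "L = I \<union> (L - I)"
        using LI by auto
      have f: "finite I" "finite (L - I)" "finite (K - L)" using LI K finS by auto
      have "gsign L (K - L) = gsign I (K - L) * gsign (L - I) (K - L)"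
        using f LI by (subst e(3), subst add1) auto
      moreover have "gsign I (K - I) = gsign I (L - I) * gsign I (K - L)"
        using f LI by (subst e(1), subst add2) auto
      ultimately show "(case case p of (L, I) \<Rightarrow> (I, L - I) of (I, J) \<Rightarrow>
          gsign I (K - I) * gsign J (K - I - J) * coeff a I * coeff b J * coeff c (K - I - J)) =
          (case p of (L, I) \<Rightarrow> gsign L (K - L) * gsign I (L - I) *
            coeff a I * coeff b (L - I) * coeff c (K - L))"
        by (simp add: LI(1) e(2))
    qed auto
    also have "\<dots> = (\<Sum>I\<in>Pow K. \<Sum>J\<in>Pow (K - I). gsign I (K - I) * gsign J (K - I - J) *
        coeff a I * coeff b J * coeff c (K - I - J))"
      using K finS by (subst sum.Sigma) auto
    also have "\<dots> = coeff (a * (b * c)) K"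
      by (simp add: times_grassmann.rep_eq sum_distrib_left sum_distrib_right mult_ac)
    finally show "coeff (a * b * c) K = coeff (a * (b * c)) K" .
  qed
qed

end

lift_definition theta :: "nat \<Rightarrow> grassmann" is "\<lambda>j I. if I = {j} then 1 else 0" by auto

definition body :: "grassmann \<Rightarrow> real" where
  "body z = coeff z {}"

definition soul :: "grassmann \<Rightarrow> grassmann" where
  "soul z = z - of_real (body z)"

text \<open>Parities are natural numbers modulo 2.\<close>

lift_definition gpart :: "nat \<Rightarrow> grassmann \<Rightarrow> grassmann" is
  "\<lambda>q a I. if card I mod 2 = q mod 2 then a I else 0" by simp

definition homogeneous :: "nat \<Rightarrow> grassmann \<Rightarrow> bool" where
  "homogeneous q z \<longleftrightarrow> gpart q z = z"

lift_definition dtheta :: "nat \<Rightarrow> grassmann \<Rightarrow> grassmann" is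
  "\<lambda>j a I. if j \<in> I then 0 else (-1) ^ card {i \<in> I. i < j} * a (insert j I)" by simp

text \<open>
  Smooth functions of an even element are given by their Taylor series in the soul.  In the algebra
  with \<open>m\<close> generators the soul \<open>\<nu>\<close> satisfies \<open>\<nu>\<^bsup>m+1\<^esup> = 0\<close>, so the series ends after the
  \<open>m\<close>-th term.  \<open>gpowr\<close> is the real power (for positive body) and \<open>ginv\<close> the inverse (for non-zero body).
\<close>

definition gexp :: "nat \<Rightarrow> grassmann \<Rightarrow> grassmann" where
  "gexp m z = exp (body z) *\<^sub>R (\<Sum>k\<le>m. (1 / fact k) *\<^sub>R soul z ^ k)"

definition gpowr :: "nat \<Rightarrow> grassmann \<Rightarrow> real \<Rightarrow> grassmann" where
  "gpowr m z r = (body z powr r) *\<^sub>R (\<Sum>k\<le>m. (r gchoose k) *\<^sub>R ((1 / body z) *\<^sub>R soul z) ^ k)"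

definition ginv :: "nat \<Rightarrow> grassmann \<Rightarrow> grassmann" where
  "ginv m z = (1 / body z) *\<^sub>R (\<Sum>k\<le>m. ((- 1 / body z) *\<^sub>R soul z) ^ k)"


section \<open>The Berezinian\<close>

text \<open>
  Determinants are only taken of matrices with even, hence commuting, entries; the order of the
  factors is irrelevant there.
\<close>

definition gdet :: "nat \<Rightarrow> (nat \<Rightarrow> nat \<Rightarrow> grassmann) \<Rightarrow> grassmann" where
  "gdet k A = (\<Sum>p | p permutes {..<k}. of_int (sign p) * (\<Prod>i\<leftarrow>[0..<k]. A i (p i)))"

text \<open>Inverse of a \<open>k \<times> k\<close> matrix by Cramer's rule; \<open>m\<close> is the number of generators.\<close>

definition gmat_inv :: "nat \<Rightarrow> nat \<Rightarrow> (nat \<Rightarrow> nat \<Rightarrow> grassmann) \<Rightarrow> nat \<Rightarrow> nat \<Rightarrow> grassmann" where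
  "gmat_inv m k A i j =
     ginv m (gdet k A) * gdet k (\<lambda>r c. if r = j then (if c = i then 1 else 0) else A r c)"

text \<open>
  The rows and columns \<open>0, \<dots>, n-1\<close> of a supermatrix are even, \<open>n, \<dots>, n+m-1\<close> are odd:
  \<open>Ber (A B; C D) = det (A - B D\<^bsup>-1\<^esup> C) (det D)\<^bsup>-1\<^esup>\<close>.
\<close>

definition Ber :: "nat \<Rightarrow> nat \<Rightarrow> (nat \<Rightarrow> nat \<Rightarrow> grassmann) \<Rightarrow> grassmann" where
  "Ber n m J =
     (let D = (\<lambda>i j. J (n + i) (n + j)) in
      gdet n (\<lambda>i j. J i j - (\<Sum>k<m. \<Sum>l<m. J i (n + k) * gmat_inv m m D k l * J (n + l) j))
        * ginv m (gdet m D))"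


section \<open>Superfunctions on domains of dimension \<open>n|m\<close>\<close>

text \<open>
  A superfunction on an open subset \<open>V\<close> of \<open>\<real>\<^sup>n\<close>, that is, an element of \<open>C\<^sup>\<infinity>(V) \<otimes> \<Lambda>(\<theta>\<^sub>0, \<dots>, \<theta>\<^bsub>m-1\<^esub>)\<close>,
  is a Grassmann-valued function on \<open>V\<close>.  As in \<^const>\<open>Euclidean_space\<close>, points of \<open>\<real>\<^sup>n\<close> are sequences
  vanishing from \<open>n\<close> on.  Values outside \<open>V\<close> are irrelevant.

  The coordinates \<open>x\<^sup>a\<close> on a domain of dimension \<open>n|m\<close> are numbered by \<open>a < n + m\<close>: those with \<open>a < n\<close>
  are even, and \<open>x\<^bsup>n+j\<^esup> = \<theta>\<^sub>j\<close>.
\<close>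

type_synonym superfun = "(nat \<Rightarrow> real) \<Rightarrow> grassmann"

definition par :: "nat \<Rightarrow> nat \<Rightarrow> nat" where
  "par n a = (if a < n then 0 else 1)"

definition coord :: "nat \<Rightarrow> nat \<Rightarrow> superfun" where
  "coord n a x = (if a < n then of_real (x a) else theta (a - n))"

definition pderiv_real :: "nat \<Rightarrow> ((nat \<Rightarrow> real) \<Rightarrow> real) \<Rightarrow> (nat \<Rightarrow> real) \<Rightarrow> real" where
  "pderiv_real a f x = deriv (\<lambda>t. f (x(a := t))) (x a)"

definition smooth_on_space :: "nat \<Rightarrow> (nat \<Rightarrow> real) set \<Rightarrow> ((nat \<Rightarrow> real) \<Rightarrow> real) \<Rightarrow> bool" where
  "smooth_on_space n V f \<longleftrightarrow>
     (\<forall>l. set l \<subseteq> {..<n} \<longrightarrow>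
        continuous_on V (foldr pderiv_real l f) \<and>
        (\<forall>a<n. \<forall>x\<in>V. (\<lambda>t. foldr pderiv_real l f (x(a := t))) differentiable at (x a)))"

definition superfunctions :: "nat \<Rightarrow> nat \<Rightarrow> (nat \<Rightarrow> real) set \<Rightarrow> superfun set" where
  "superfunctions n m V =
     {f. (\<forall>x\<in>V. \<forall>I. coeff (f x) I \<noteq> 0 \<longrightarrow> I \<subseteq> {..<m}) \<and>
         (\<forall>I. smooth_on_space n V (\<lambda>x. coeff (f x) I))}"

text \<open>The left partial derivative \<open>\<partial>f/\<partial>x\<^sup>a\<close>.\<close>

definition pd :: "nat \<Rightarrow> nat \<Rightarrow> superfun \<Rightarrow> superfun" where
  "pd n a f x =
     (if a < n then Grassmann (\<lambda>I. pderiv_real a (\<lambda>y. coeff (f y) I) x)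
      else dtheta (a - n) (f x))"

text \<open>
  Pullback of \<open>f\<close> along the morphism with coordinate components \<open>\<Phi>\<^sup>a\<close>, \<open>a < n + m\<close>, between domains
  of dimension \<open>n|m\<close>: writing \<open>\<Phi>\<^sup>a = \<phi>\<^sup>a + \<nu>\<^sup>a\<close> (body and soul) for even \<open>a\<close>, the coefficient
  functions of \<open>f\<close> are expanded in their Taylor series in \<open>\<nu>\<close> at \<open>\<phi>(x)\<close>; the product over \<open>l\<close> of
  \<open>\<nu>\<close>'s vanishes for more than \<open>m\<close> factors.
\<close>

definition base_map :: "nat \<Rightarrow> (nat \<Rightarrow> superfun) \<Rightarrow> (nat \<Rightarrow> real) \<Rightarrow> (nat \<Rightarrow> real)" where
  "base_map n \<Phi> x = (\<lambda>a. if a < n then body (\<Phi> a x) else 0)"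

definition pullback :: "nat \<Rightarrow> nat \<Rightarrow> (nat \<Rightarrow> superfun) \<Rightarrow> superfun \<Rightarrow> superfun" where
  "pullback n m \<Phi> f x =
     (\<Sum>I\<in>Pow {..<m}. \<Sum>k\<le>m. \<Sum>l | set l \<subseteq> {..<n} \<and> length l = k.
        (foldr pderiv_real l (\<lambda>y. coeff (f y) I) (base_map n \<Phi> x) / fact k) *\<^sub>R
        ((\<Prod>a\<leftarrow>l. soul (\<Phi> a x)) * (\<Prod>j\<leftarrow>sorted_list_of_set I. \<Phi> (n + j) x)))"


section \<open>Supermanifolds\<close>

text \<open>
  A supermanifold of dimension \<open>n|m\<close> is given by an atlas: charts \<open>chart i\<close> of the underlying
  topological space defined on open sets \<open>chart_dom i\<close>, and superdomain morphisms between the images.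
  \<open>transition M i j a\<close> is the coordinate \<open>x\<^sup>a\<close> of chart \<open>j\<close> as a function of the coordinates of chart \<open>i\<close>.
\<close>

record ('p, 'i) supermanifold =
  evdim :: nat
  odim :: nat
  base :: "'p topology"
  charts :: "'i set"
  chart_dom :: "'i \<Rightarrow> 'p set"
  chart :: "'i \<Rightarrow> 'p \<Rightarrow> (nat \<Rightarrow> real)"
  transition :: "'i \<Rightarrow> 'i \<Rightarrow> nat \<Rightarrow> superfun"

definition image_dom :: "('p, 'i) supermanifold \<Rightarrow> 'i \<Rightarrow> (nat \<Rightarrow> real) set" where
  "image_dom M i = chart M i ` chart_dom M i"

definition overlap :: "('p, 'i) supermanifold \<Rightarrow> 'i \<Rightarrow> 'i \<Rightarrow> (nat \<Rightarrow> real) set" where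
  "overlap M i j = chart M i ` (chart_dom M i \<inter> chart_dom M j)"

definition pull :: "('p, 'i) supermanifold \<Rightarrow> 'i \<Rightarrow> 'i \<Rightarrow> superfun \<Rightarrow> superfun" where
  "pull M i j = pullback (evdim M) (odim M) (transition M i j)"

definition is_supermanifold :: "('p, 'i) supermanifold \<Rightarrow> bool" where
  "is_supermanifold M \<longleftrightarrow>
     Hausdorff_space (base M) \<and> second_countable (base M) \<and>
     topspace (base M) = (\<Union>i\<in>charts M. chart_dom M i) \<and>
     (\<forall>i\<in>charts M.
        openin (base M) (chart_dom M i) \<and>
        openin (Euclidean_space (evdim M)) (image_dom M i) \<and>
        homeomorphic_map (subtopology (base M) (chart_dom M i))
          (subtopology (Euclidean_space (evdim M)) (image_dom M i)) (chart M i)) \<and>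
     (\<forall>i\<in>charts M. \<forall>j\<in>charts M. \<forall>a < evdim M + odim M.
        transition M i j a \<in> superfunctions (evdim M) (odim M) (overlap M i j) \<and>
        (\<forall>x\<in>overlap M i j. homogeneous (par (evdim M) a) (transition M i j a x)) \<and>
        (a < evdim M \<longrightarrow>
          (\<forall>p\<in>chart_dom M i \<inter> chart_dom M j. body (transition M i j a (chart M i p)) = chart M j p a))) \<and>
     (\<forall>i\<in>charts M. \<forall>a < evdim M + odim M. \<forall>x\<in>image_dom M i.
        transition M i i a x = coord (evdim M) a x) \<and>
     (\<forall>i\<in>charts M. \<forall>j\<in>charts M. \<forall>k\<in>charts M. \<forall>a < evdim M + odim M.
        \<forall>x\<in>chart M i ` (chart_dom M i \<inter> chart_dom M j \<inter> chart_dom M k).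
          transition M i k a x = pull M i j (transition M j k a) x)"

text \<open>
  The Jacobian matrix \<open>\<partial>x\<^sub>j\<^sup>b/\<partial>x\<^sub>i\<^sup>a\<close> with rows \<open>a\<close> and columns \<open>b\<close>; with left derivatives this is the
  convention for which Jacobian matrices of compositions multiply.
\<close>

definition jacobian :: "('p, 'i) supermanifold \<Rightarrow> 'i \<Rightarrow> 'i \<Rightarrow> (nat \<Rightarrow> real) \<Rightarrow> nat \<Rightarrow> nat \<Rightarrow> grassmann"
  where "jacobian M i j x a b = pd (evdim M) a (transition M i j b) x"

definition Ber_trans :: "('p, 'i) supermanifold \<Rightarrow> 'i \<Rightarrow> 'i \<Rightarrow> superfun" where
  "Ber_trans M i j x = Ber (evdim M) (odim M) (jacobian M i j x)"

text \<open>
  Orientation in the sense needed for real powers of volume forms: the Berezinians of all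
  coordinate changes are positive.
\<close>

definition oriented :: "('p, 'i) supermanifold \<Rightarrow> bool" where
  "oriented M \<longleftrightarrow> (\<forall>i\<in>charts M. \<forall>j\<in>charts M. \<forall>x\<in>overlap M i j. body (Ber_trans M i j x) > 0)"

text \<open>Functions, volume forms, half-densities and so on are families of their representatives in the charts.\<close>

type_synonym 'i local_family = "'i \<Rightarrow> superfun"

definition section_eq :: "('p, 'i) supermanifold \<Rightarrow> 'i local_family \<Rightarrow> 'i local_family \<Rightarrow> bool" where
  "section_eq M f g \<longleftrightarrow> (\<forall>i\<in>charts M. \<forall>x\<in>image_dom M i. f i x = g i x)"

definition local_smooth :: "('p, 'i) supermanifold \<Rightarrow> 'i local_family \<Rightarrow> bool" where
  "local_smooth M f \<longleftrightarrow>
     (\<forall>i\<in>charts M. f i \<in> superfunctions (evdim M) (odim M) (image_dom M i))"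

definition global_functions :: "('p, 'i) supermanifold \<Rightarrow> 'i local_family set" where
  "global_functions M =
     {f. local_smooth M f \<and>
         (\<forall>i\<in>charts M. \<forall>j\<in>charts M. \<forall>x\<in>overlap M i j. f i x = pull M i j (f j) x)}"

definition even_functions :: "('p, 'i) supermanifold \<Rightarrow> 'i local_family set" where
  "even_functions M =
     {f \<in> global_functions M. \<forall>i\<in>charts M. \<forall>x\<in>image_dom M i. homogeneous 0 (f i x)}"

text \<open>\<open>\<rho>\<^sub>i Dx\<^sub>i = \<rho>\<^sub>j Dx\<^sub>j\<close>, where \<open>Dx\<^sub>j = Ber(\<partial>x\<^sub>j/\<partial>x\<^sub>i) Dx\<^sub>i\<close>.\<close>

definition volume_forms :: "('p, 'i) supermanifold \<Rightarrow> 'i local_family set" where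
  "volume_forms M =
     {\<rho>. local_smooth M \<rho> \<and>
         (\<forall>i\<in>charts M. \<forall>j\<in>charts M. \<forall>x\<in>overlap M i j.
            \<rho> i x = pull M i j (\<rho> j) x * Ber_trans M i j x)}"

text \<open>Non-degenerate volume forms, with the standing convention that coefficients are positive.\<close>

definition nondeg_volume_forms :: "('p, 'i) supermanifold \<Rightarrow> 'i local_family set" where
  "nondeg_volume_forms M =
     {\<rho> \<in> volume_forms M.
        \<forall>i\<in>charts M. \<forall>x\<in>image_dom M i. homogeneous 0 (\<rho> i x) \<and> body (\<rho> i x) > 0}"

definition half_densities :: "('p, 'i) supermanifold \<Rightarrow> 'i local_family set" where
  "half_densities M =
     {s. local_smooth M s \<and>
         (\<forall>i\<in>charts M. \<forall>j\<in>charts M. \<forall>x\<in>overlap M i j.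
            s i x = pull M i j (s j) x * gpowr (odim M) (Ber_trans M i j x) (1/2))}"


section \<open>Odd Poisson structures\<close>

text \<open>
  Coordinates on the cotangent bundle of a domain of dimension \<open>n|m\<close>, a domain of dimension
  \<open>2n|2m\<close>: the even ones are \<open>x\<^sup>0, \<dots>, x\<^bsup>n-1\<^esup>, p\<^sub>0, \<dots>, p\<^bsub>n-1\<^esub>\<close>, the odd ones
  \<open>x\<^sup>n, \<dots>, x\<^bsup>n+m-1\<^esup>, p\<^sub>n, \<dots>, p\<^bsub>n+m-1\<^esub>\<close>.  \<open>cot_x\<close> and \<open>cot_p\<close> are the numbers of \<open>x\<^sup>a\<close> and \<open>p\<^sub>a\<close>.
\<close>

definition cot_x :: "nat \<Rightarrow> nat \<Rightarrow> nat" where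
  "cot_x n a = (if a < n then a else n + a)"

definition cot_p :: "nat \<Rightarrow> nat \<Rightarrow> nat \<Rightarrow> nat" where
  "cot_p n m a = (if a < n then n + a else n + m + a)"

definition cot_proj :: "nat \<Rightarrow> (nat \<Rightarrow> real) \<Rightarrow> (nat \<Rightarrow> real)" where
  "cot_proj n y = (\<lambda>a. if a < n then y a else 0)"

definition cot_dom :: "nat \<Rightarrow> (nat \<Rightarrow> real) set \<Rightarrow> (nat \<Rightarrow> real) set" where
  "cot_dom n V = {y \<in> topspace (Euclidean_space (2 * n)). cot_proj n y \<in> V}"

definition momentum :: "nat \<Rightarrow> nat \<Rightarrow> nat \<Rightarrow> superfun" where
  "momentum n m a = coord (2 * n) (cot_p n m a)"

text \<open>
  The canonical even Poisson bracket on the cotangent bundle, normalized by \<open>(p\<^sub>a, x\<^sup>b) = \<delta>\<^sub>a\<^sup>b\<close>.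
  For \<open>F\<close> of parity \<open>q\<close> it is
  \<open>\<Sum>\<^sub>a (-1)\<^bsup>a(q+1)\<^esup> \<partial>F/\<partial>p\<^sub>a \<partial>G/\<partial>x\<^sup>a - (-1)\<^bsup>aq\<^esup> \<partial>F/\<partial>x\<^sup>a \<partial>G/\<partial>p\<^sub>a\<close> (with \<open>a\<close> in exponents standing for
  the parity of \<open>x\<^sup>a\<close>); a general \<open>F\<close> is split into its homogeneous parts.
\<close>

definition canonical_bracket :: "nat \<Rightarrow> nat \<Rightarrow> superfun \<Rightarrow> superfun \<Rightarrow> superfun" where
  "canonical_bracket n m F G y =
     (\<Sum>q<2. \<Sum>a<n + m.
        (-1) ^ (par n a * (q + 1)) *
          pd (2 * n) (cot_p n m a) (\<lambda>y. gpart q (F y)) y * pd (2 * n) (cot_x n a) G y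
        - (-1) ^ (par n a * q) *
          pd (2 * n) (cot_x n a) (\<lambda>y. gpart q (F y)) y * pd (2 * n) (cot_p n m a) G y)"

text \<open>\<open>\<SS> = 1/2 \<Sum>\<^sub>a\<^sub>b S\<^sup>a\<^sup>b p\<^sub>b p\<^sub>a\<close>.\<close>

definition quadratic_ham :: "nat \<Rightarrow> nat \<Rightarrow> (nat \<Rightarrow> nat \<Rightarrow> superfun) \<Rightarrow> superfun" where
  "quadratic_ham n m S y =
     (1/2) *\<^sub>R (\<Sum>a<n + m. \<Sum>b<n + m. S a b (cot_proj n y) * momentum n m b y * momentum n m a y)"

text \<open>
  The coordinate change on the cotangent bundle induced by the change from chart \<open>i\<close> to chart \<open>j\<close>:
  \<open>x\<^sub>j\<close> is as before and the momenta are related by \<open>p'\<^sub>b = \<Sum>\<^sub>a (\<partial>x\<^sub>i\<^sup>a/\<partial>x\<^sub>j\<^sup>b) p\<^sub>a\<close>.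
  The four ranges of \<open>c\<close> are those of the numbering of coordinates above.
\<close>

definition cot_trans :: "('p, 'i) supermanifold \<Rightarrow> 'i \<Rightarrow> 'i \<Rightarrow> nat \<Rightarrow> superfun" where
  "cot_trans M i j c y =
     (let n = evdim M; m = odim M; x = cot_proj n y;
          p' = (\<lambda>b. \<Sum>a<n + m. pull M i j (pd n b (transition M j i a)) x * momentum n m a y)
      in if c < n then transition M i j c x
         else if c < 2 * n then p' (c - n)
         else if c < 2 * n + m then transition M i j (c - n) x
         else p' (c - n - m))"

text \<open>
  An odd Poisson structure, given by its components \<open>S i a b\<close> in the charts \<open>i\<close>: the local odd
  functions \<open>\<SS>\<close> define one function on the cotangent bundle, and \<open>(\<SS>, \<SS>) = 0\<close>.
\<close>

definition odd_Poisson_structure ::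
  "('p, 'i) supermanifold \<Rightarrow> ('i \<Rightarrow> nat \<Rightarrow> nat \<Rightarrow> superfun) \<Rightarrow> bool" where
  "odd_Poisson_structure M S \<longleftrightarrow>
     (let n = evdim M; m = odim M; H = (\<lambda>i. quadratic_ham n m (S i)) in
      (\<forall>i\<in>charts M. \<forall>a<n + m. \<forall>b<n + m.
         S i a b \<in> superfunctions n m (image_dom M i) \<and>
         (\<forall>x\<in>image_dom M i.
            homogeneous (par n a + par n b + 1) (S i a b x) \<and>
            S i a b x = (-1) ^ (par n a * par n b) * S i b a x)) \<and>
      (\<forall>i\<in>charts M. \<forall>j\<in>charts M. \<forall>y\<in>cot_dom n (overlap M i j).
         H i y = pullback (2 * n) (2 * m) (cot_trans M i j) (H j) y) \<and>
      (\<forall>i\<in>charts M. \<forall>y\<in>cot_dom n (image_dom M i). canonical_bracket n m (H i) (H i) y = 0))"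


section \<open>Odd Laplace operators\<close>

text \<open>
  The following are the expressions in one chart, with \<open>S\<close> the components of the odd Poisson
  structure.  \<open>odd_bracket\<close> and \<open>ham_field\<close> are meant for \<open>f\<close> homogeneous of parity \<open>q\<close>, and
  \<open>divergence\<close> for a vector field \<open>X\<close> of parity \<open>q\<close>.
\<close>

definition odd_bracket ::
  "nat \<Rightarrow> nat \<Rightarrow> (nat \<Rightarrow> nat \<Rightarrow> superfun) \<Rightarrow> nat \<Rightarrow> superfun \<Rightarrow> superfun \<Rightarrow> superfun" where
  "odd_bracket n m S q f g x =
     - (\<Sum>a<n + m. \<Sum>b<n + m. (-1) ^ (q * (par n a + 1)) * S a b x * pd n b f x * pd n a g x)"

text \<open>The components \<open>X\<^sub>f\<^sup>a = X\<^sub>f x\<^sup>a\<close> of \<open>X\<^sub>f = (-1)\<^bsup>q+1\<^esup> {f, \<cdot>}\<close>.\<close>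

definition ham_field ::
  "nat \<Rightarrow> nat \<Rightarrow> (nat \<Rightarrow> nat \<Rightarrow> superfun) \<Rightarrow> nat \<Rightarrow> superfun \<Rightarrow> nat \<Rightarrow> superfun" where
  "ham_field n m S q f a x = (-1) ^ (q + 1) * odd_bracket n m S q f (coord n a) x"

definition divergence :: "nat \<Rightarrow> nat \<Rightarrow> superfun \<Rightarrow> nat \<Rightarrow> (nat \<Rightarrow> superfun) \<Rightarrow> superfun" where
  "divergence n m \<rho> q X x =
     ginv m (\<rho> x) * (\<Sum>a<n + m. (-1) ^ (par n a * (q + 1)) * pd n a (\<lambda>y. \<rho> y * X a y) x)"

text \<open>\<open>\<Delta>\<^sub>\<rho> f = div\<^sub>\<rho> X\<^sub>f\<close>, extended linearly from homogeneous to all \<open>f\<close>.\<close>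

definition odd_Laplace ::
  "('p, 'i) supermanifold \<Rightarrow> ('i \<Rightarrow> nat \<Rightarrow> nat \<Rightarrow> superfun) \<Rightarrow> 'i local_family \<Rightarrow>
    'i local_family \<Rightarrow> 'i local_family" where
  "odd_Laplace M S \<rho> f i x =
     (let n = evdim M; m = odim M in
      \<Sum>q<2. divergence n m (\<rho> i) (q + 1) (ham_field n m (S i) q (\<lambda>y. gpart q (f i y))) x)"

definition odd_Laplace_half ::
  "('p, 'i) supermanifold \<Rightarrow> ('i \<Rightarrow> nat \<Rightarrow> nat \<Rightarrow> superfun) \<Rightarrow> 'i local_family \<Rightarrow>
    'i local_family \<Rightarrow> 'i local_family" where
  "odd_Laplace_half M S \<rho> s i x =
     gpowr (odim M) (\<rho> i x) (1/2) *
       odd_Laplace M S \<rho> (\<lambda>j y. s j y * gpowr (odim M) (\<rho> j y) (- 1/2)) i x"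


section \<open>The master groupoid\<close>

text \<open>The arrows \<open>\<rho> \<rightarrow> \<rho>'\<close>: the functions \<open>e\<^sup>\<sigma>\<close> with \<open>\<rho>' = e\<^sup>\<sigma> \<rho>\<close> and \<open>\<Delta>\<^sub>\<rho> e\<^bsup>\<sigma>/2\<^esup> = 0\<close>.\<close>

definition master_arrow ::
  "('p, 'i) supermanifold \<Rightarrow> ('i \<Rightarrow> nat \<Rightarrow> nat \<Rightarrow> superfun) \<Rightarrow> 'i local_family \<Rightarrow>
    'i local_family \<Rightarrow> 'i local_family \<Rightarrow> bool" where
  "master_arrow M S \<rho> \<rho>' u \<longleftrightarrow>
     \<rho> \<in> nondeg_volume_forms M \<and> \<rho>' \<in> nondeg_volume_forms M \<and>
     (\<exists>\<sigma>\<in>even_functions M.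
        section_eq M u (\<lambda>i x. gexp (odim M) (\<sigma> i x)) \<and>
        section_eq M \<rho>' (\<lambda>i x. u i x * \<rho> i x) \<and>
        section_eq M (odd_Laplace M S \<rho> (\<lambda>i x. gexp (odim M) ((1/2) *\<^sub>R \<sigma> i x))) (\<lambda>i x. 0))"

definition same_orbit ::
  "('p, 'i) supermanifold \<Rightarrow> ('i \<Rightarrow> nat \<Rightarrow> nat \<Rightarrow> superfun) \<Rightarrow> 'i local_family \<Rightarrow>
    'i local_family \<Rightarrow> bool" where
  "same_orbit M S \<rho> \<rho>' \<longleftrightarrow> (\<exists>u. master_arrow M S \<rho> \<rho>' u)"

end

theory Submission
  imports Defs
begin

text \<open>
  Work in one chart and write \<open>D f = \<partial>\<^sub>a(S\<^sup>a\<^sup>b \<partial>\<^sub>b f)\<close> for the operator belonging to the coordinate volume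
  element.  For even invertible \<open>r\<close> with \<open>r\<^sup>2 = \<rho>\<close>, the first order cross terms of \<open>D (r f)\<close> combine, by
  the graded symmetry of \<open>S\<close>, so that \<open>\<partial>\<^sub>a(\<rho> S\<^sup>a\<^sup>b \<partial>\<^sub>b f) = r (D (r f) - (D r) f)\<close>.  Hence the Laplace operator
  on half-densities is \<open>s \<mapsto> D s - (D r) r\<^sup>-\<^sup>1 s\<close>, a Schroedinger operator whose potential alone depends
  on \<open>\<rho>\<close>.  For the same reason \<open>\<Delta>\<^sub>\<rho> E = 0\<close> with \<open>E = exp (\<sigma>/2)\<close> says \<open>D (r E) = (D r) E\<close>; as \<open>r E\<close> is the
  positive square root of \<open>\<rho>'\<close>, the potentials of \<open>\<rho>\<close> and \<open>\<rho>'\<close> agree.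
\<close>

section \<open>Grassmann algebra\<close>

lemmas coeff_mult = times_grassmann.rep_eq
lemmas coeff_simps [simp] = plus_grassmann.rep_eq minus_grassmann.rep_eq uminus_grassmann.rep_eq
  zero_grassmann.rep_eq scaleR_grassmann.rep_eq one_grassmann.rep_eq

lemma coeff_of_real [simp]: "coeff (of_real c) I = (if I = {} then c else 0)"
  by (simp add: of_real_def)

lemma coeff_sum: "coeff (\<Sum>x\<in>A. f x) I = (\<Sum>x\<in>A. coeff (f x) I)"
  by (induction A rule: infinite_finite_induct) auto

lemma gsign_Un_left:
  assumes "finite I" "finite J" "finite L" "I \<inter> J = {}"
  shows "gsign (I \<union> J) L = gsign I L * gsign J L"
proof -
  have "{(i, j) \<in> (I \<union> J) \<times> L. j < i} = {(i, j) \<in> I \<times> L. j < i} \<union> {(i, j) \<in> J \<times> L. j < i}"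
    by auto
  moreover have "finite {(i, j) \<in> I \<times> L. j < i}" "finite {(i, j) \<in> J \<times> L. j < i}"
    using assms by (auto intro: finite_subset[of _ "I \<times> L"] finite_subset[of _ "J \<times> L"])
  moreover have "{(i, j) \<in> I \<times> L. j < i} \<inter> {(i, j) \<in> J \<times> L. j < i} = {}"
    using assms by auto
  ultimately show ?thesis
    by (simp add: gsign_def card_Un_disjoint flip: power_add)
qed

text \<open>For disjoint \<open>I\<close> and \<open>J\<close>, each pair in
  \<open>I \<times> J\<close> is an inversion for exactly one of the two orders of the factors, so
  the two inversion counts add up to \<open>card I * card J\<close>.\<close>

lemma gsign_swap:
  assumes "finite I" "finite J" "I \<inter> J = {}"
  shows "gsign I J = (-1) ^ (card I * card J) * gsign J I"
proof -
  let ?A = "{(i, j) \<in> I \<times> J. j < i}" and ?B = "{(i, j) \<in> I \<times> J. i < j}"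
  have fin: "finite ?A" "finite ?B"
    using assms by (auto intro: finite_subset[of _ "I \<times> J"])
  have "card ?B = card {(i, j) \<in> J \<times> I. j < i}"
    by (rule bij_betw_same_card[of prod.swap]) (auto simp: bij_betw_def inj_on_def image_iff)
  moreover have "card ?A + card ?B = card (I \<times> J)"
  proof -
    have "I \<times> J = ?A \<union> ?B"
      using assms by (auto dest: linorder_neqE_nat)
    moreover have "?A \<inter> ?B = {}"
      by auto
    ultimately show ?thesis
      using card_Un_disjoint[OF fin] by argo
  qed
  ultimately have "(-1 :: real) ^ (card I * card J) = gsign I J * gsign J I"
    by (simp add: gsign_def card_cartesian_product flip: power_add)
  moreover have "gsign J I * gsign J I = 1"
    by (simp add: gsign_def flip: power_add)
  ultimately show ?thesis
    by (simp add: mult.assoc)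
qed

lemma gsign_Un_right:
  assumes "finite I" "finite J" "finite L" "I \<inter> J = {}" "(I \<union> J) \<inter> L = {}"
  shows "gsign L (I \<union> J) = gsign L I * gsign L J"
proof -
  have "{(i, j) \<in> L \<times> (I \<union> J). j < i} = {(i, j) \<in> L \<times> I. j < i} \<union> {(i, j) \<in> L \<times> J. j < i}"
    by auto
  moreover have "finite {(i, j) \<in> L \<times> I. j < i}" "finite {(i, j) \<in> L \<times> J. j < i}"
    using assms by (auto intro: finite_subset[of _ "L \<times> I"] finite_subset[of _ "L \<times> J"])
  moreover have "{(i, j) \<in> L \<times> I. j < i} \<inter> {(i, j) \<in> L \<times> J. j < i} = {}"
    using assms by auto
  ultimately show ?thesis
    by (simp add: gsign_def card_Un_disjoint flip: power_add)
qed

lemma gsign_singleton: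
  "gsign {j} J = (-1) ^ card {i \<in> J. i < j}"
  "gsign I {j} = (-1) ^ card {i \<in> I. j < i}"
proof -
  have "card {(i, k) \<in> {j} \<times> J. k < i} = card {i \<in> J. i < j}"
    by (rule bij_betw_same_card[of snd]) (auto simp: bij_betw_def inj_on_def image_iff)
  moreover have "card {(i, k) \<in> I \<times> {j}. k < i} = card {i \<in> I. j < i}"
    by (rule bij_betw_same_card[of fst]) (auto simp: bij_betw_def inj_on_def image_iff)
  ultimately show "gsign {j} J = (-1) ^ card {i \<in> J. i < j}"
    "gsign I {j} = (-1) ^ card {i \<in> I. j < i}"
    by (simp_all add: gsign_def)
qed

subsection \<open>Parity\<close>

lemma homogeneous_iff:
  "homogeneous q z \<longleftrightarrow> (\<forall>I. coeff z I \<noteq> 0 \<longrightarrow> card I mod 2 = q mod 2)"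
  unfolding homogeneous_def
  by (metis gpart.rep_eq grassmann_eqI)

lemma homogeneous_mod: "homogeneous p z \<Longrightarrow> p mod 2 = q mod 2 \<Longrightarrow> homogeneous q z"
  by (simp add: homogeneous_iff)

lemma homogeneous_add: "homogeneous q y \<Longrightarrow> homogeneous q z \<Longrightarrow> homogeneous q (y + z)"
  by (auto simp: homogeneous_iff) (metis add.right_neutral)

lemma homogeneous_0 [simp]: "homogeneous q 0"
  by (simp add: homogeneous_iff)

lemma homogeneous_scaleR: "homogeneous q z \<Longrightarrow> homogeneous q (c *\<^sub>R z)"
  by (auto simp: homogeneous_iff)

lemma homogeneous_of_real [simp]: "homogeneous 0 (of_real c)"
  by (auto simp: homogeneous_iff)

lemma homogeneous_1 [simp]: "homogeneous 0 1"
  using homogeneous_of_real[of 1] by simp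

lemma homogeneous_diff: "homogeneous q y \<Longrightarrow> homogeneous q z \<Longrightarrow> homogeneous q (y - z)"
  using homogeneous_add[of q y "(-1) *\<^sub>R z"] homogeneous_scaleR[of q z "-1"] by simp

lemma homogeneous_sum: "(\<And>x. x \<in> A \<Longrightarrow> homogeneous q (f x)) \<Longrightarrow> homogeneous q (\<Sum>x\<in>A. f x)"
  by (induction A rule: infinite_finite_induct) (auto intro: homogeneous_add)

text \<open>A nonzero coefficient of a product comes from a splitting of its index set into two
  disjoint parts. Additivity of parities, closure of \<open>grassmann_in\<close> and nilpotency of
  souls are all read off from such a splitting.\<close>

lemma coeff_mult_nonzeroE:
  assumes "coeff (y * z) K \<noteq> 0"
  obtains I where "I \<subseteq> K" "coeff y I \<noteq> 0" "coeff z (K - I) \<noteq> 0" "finite K"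
proof -
  obtain I where "I \<in> Pow K" "gsign I (K - I) * coeff y I * coeff z (K - I) \<noteq> 0"
    using assms unfolding coeff_mult by (rule sum.not_neutral_contains_not_neutral)
  moreover have "finite K"
    using assms coeff_infinite by blast
  ultimately show ?thesis
    using that by auto
qed

lemma homogeneous_mult:
  assumes "homogeneous p y" "homogeneous q z"
  shows "homogeneous (p + q) (y * z)"
  unfolding homogeneous_iff
proof (intro allI impI)
  fix K assume "coeff (y * z) K \<noteq> 0"
  then obtain I where I: "I \<subseteq> K" "coeff y I \<noteq> 0" "coeff z (K - I) \<noteq> 0" "finite K"
    by (rule coeff_mult_nonzeroE)
  then have "card K = card I + card (K - I)"
    by (metis card_Diff_subset card_mono finite_subset le_add_diff_inverse)
  then show "card K mod 2 = (p + q) mod 2"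
    using assms I by (auto simp: homogeneous_iff intro: mod_add_cong)
qed

lemma homogeneous_0_mult: "homogeneous 0 y \<Longrightarrow> homogeneous 0 z \<Longrightarrow> homogeneous 0 (y * z)"
  using homogeneous_mult[of 0 y 0 z] by simp

lemma homogeneous_0_power: "homogeneous 0 z \<Longrightarrow> homogeneous 0 (z ^ k)"
  by (induction k) (auto intro: homogeneous_0_mult)

lemma coeff_uminus_one_power_mult: "coeff ((-1) ^ k * z) I = (-1) ^ k * coeff z I"
  by (induction k) (simp_all add: mult.assoc)

text \<open>The \<open>I\<close>-term of \<open>y * z\<close> is matched with the term of
  \<open>z * y\<close> belonging to the complement of \<open>I\<close>; complementation permutes the
  subsets of \<open>K\<close>. Where neither coefficient vanishes, the two cardinalities have the
  parities \<open>p\<close> and \<open>q\<close>, so \<open>gsign_swap\<close> yields one sign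
  common to all terms.\<close>

lemma supercommute:
  assumes "homogeneous p y" "homogeneous q z"
  shows "y * z = (-1) ^ (p * q) * (z * y)"
proof (rule grassmann_eqI)
  fix K :: "nat set" assume K: "finite K"
  have "gsign I (K - I) * coeff y I * coeff z (K - I) =
      (-1) ^ (p * q) * (gsign (K - I) I * coeff z (K - I) * coeff y I)" if "I \<subseteq> K" for I
  proof (cases "coeff y I = 0 \<or> coeff z (K - I) = 0")
    case False
    then have "card I mod 2 = p mod 2" "card (K - I) mod 2 = q mod 2"
      using assms by (auto simp: homogeneous_iff)
    then have "even (card I * card (K - I)) \<longleftrightarrow> even (p * q)"
      by (metis dvd_mod_iff dvd_refl even_mult_iff)
    then have "(-1 :: real) ^ (card I * card (K - I)) = (-1) ^ (p * q)"
      by (auto simp: minus_one_power_iff)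
    then show ?thesis
      using that K gsign_swap[of I "K - I"] by (simp add: finite_subset)
  qed auto
  then have "coeff (y * z) K = (\<Sum>I\<in>Pow K. (-1) ^ (p * q) * (gsign (K - I) I * coeff z (K - I) * coeff y I))"
    unfolding coeff_mult by (intro sum.cong) auto
  also have "\<dots> = (\<Sum>I\<in>Pow K. (-1) ^ (p * q) * (gsign I (K - I) * coeff z I * coeff y (K - I)))"
    by (rule sum.reindex_bij_witness[of _ "\<lambda>I. K - I" "\<lambda>I. K - I"]) (auto simp: double_diff)
  also have "\<dots> = coeff ((-1) ^ (p * q) * (z * y)) K"
    unfolding coeff_uminus_one_power_mult coeff_mult[of z y] sum_distrib_left ..
  finally show "coeff (y * z) K = coeff ((-1) ^ (p * q) * (z * y)) K" .
qed

lemma gpart_sum: "gpart 0 z + gpart (Suc 0) z = z"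
  by (rule grassmann_eqI) (auto simp: gpart.rep_eq)

lemma homogeneous_gpart: "homogeneous q (gpart q z)"
  by (simp add: homogeneous_iff gpart.rep_eq)

text \<open>An even factor passes both parity parts of \<open>z\<close> without a sign, so
  \<open>z\<close> may be of mixed parity.\<close>

lemma even_commute:
  assumes "homogeneous 0 y"
  shows "y * z = z * y"
proof -
  have "y * gpart q z = gpart q z * y" for q
    using supercommute[OF assms homogeneous_gpart, of q z] by simp
  then have "y * (gpart 0 z + gpart (Suc 0) z) = (gpart 0 z + gpart (Suc 0) z) * y"
    by (simp add: algebra_simps)
  then show ?thesis
    by (simp add: gpart_sum)
qed

section \<open>The left derivative by an odd generator\<close>

lemma homogeneous_dtheta:
  assumes "homogeneous q z"
  shows "homogeneous (q + 1) (dtheta j z)"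
  unfolding homogeneous_iff
proof (intro allI impI)
  fix I assume nz: "coeff (dtheta j z) I \<noteq> 0"
  then have "j \<notin> I" "coeff z (insert j I) \<noteq> 0"
    by (auto simp: dtheta.rep_eq split: if_splits)
  moreover from nz have "finite I"
    using coeff_infinite by blast
  ultimately have "Suc (card I) mod 2 = q mod 2"
    using assms by (auto simp: homogeneous_iff)
  then show "card I mod 2 = (q + 1) mod 2"
    by presburger
qed

text \<open>The graded Leibniz rule, checked on the coefficient at \<open>K\<close>. If
  \<open>j\<close> lies in \<open>K\<close>, the left side vanishes, and on the right the
  contributions where both factors contain the generator \<open>j\<close> cancel. Otherwise each
  subset of \<open>insert j K\<close> assigns this generator to one of the two factors, which
  accounts for the two terms of the rule.\<close>

lemma dtheta_mult:
  assumes "homogeneous q y"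
  shows "dtheta j (y * z) = dtheta j y * z + (-1) ^ q * (y * dtheta j z)"
proof (rule grassmann_eqI)
  fix K :: "nat set" assume K: "finite K"
  define K' where "K' = K - {j}"
  \<comment> \<open>This is the sign with which \<open>dtheta\<close> moves the generator
    \<open>j\<close> to the front of the monomial of \<open>I\<close>; it equals
    \<open>gsign {j} I\<close>.\<close>
  define s where "s I = (-1 :: real) ^ card {i \<in> I. i < j}" for I
  have K': "finite K'" "j \<notin> K'"
    using K by (auto simp: K'_def)
  have fin: "finite I" if "I \<subseteq> K'" for I
    using that K' finite_subset by blast
  have sgn1: "gsign (insert j I) J = gsign I J * s J"
    if "I \<subseteq> K'" "J \<subseteq> K'" for I J
  proof -
    have "j \<notin> I" using that K' by auto
    then show ?thesis
      using gsign_Un_left[of I "{j}" J] fin that by (simp add: gsign_singleton s_def)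
  qed
  \<comment> \<open>In the second equation \<open>y\<close> is read at \<open>insert j I\<close>, so
    the parity of \<open>y\<close> fixes \<open>card I\<close> only up to the one additional
    generator; this is the origin of the extra minus sign.\<close>
  have sgn2: "gsign I (insert j J) * s I * coeff y I = gsign I J * (-1) ^ q * coeff y I"
    "gsign I (insert j J) * s I * coeff y (insert j I) = gsign I J * - ((-1) ^ q) * coeff y (insert j I)"
    if "I \<subseteq> K'" "J = K' - I" for I J
  proof -
    have nj: "j \<notin> I" using that K' by auto
    have "card I = card {i \<in> I. j < i} + card {i \<in> I. i < j}"
    proof -
      have "j < i \<or> i < j" if "i \<in> I" for i
        using that nj by (cases j i rule: linorder_cases) auto
      then have "{i \<in> I. j < i} \<union> {i \<in> I. i < j} = I"
        by blast
      moreover have "card ({i \<in> I. j < i} \<union> {i \<in> I. i < j}) = card {i \<in> I. j < i} + card {i \<in> I. i < j}"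
        using fin[OF that(1)] by (intro card_Un_disjoint) auto
      ultimately show ?thesis
        by simp
    qed
    then have *: "gsign I (insert j J) * s I = gsign I J * (-1) ^ card I"
      using gsign_Un_right[of J "{j}" I] fin[of I] fin[of J] that K'
      by (auto simp: gsign_singleton s_def power_add)
    have "(-1 :: real) ^ card I = (-1) ^ q" if "coeff y I \<noteq> 0"
      using that assms by (auto simp: homogeneous_iff minus_one_power_iff even_iff_mod_2_eq_zero)
    then show "gsign I (insert j J) * s I * coeff y I = gsign I J * (-1) ^ q * coeff y I"
      using * by auto
    have "(-1 :: real) ^ card I = - ((-1) ^ q)" if "coeff y (insert j I) \<noteq> 0"
    proof -
      have "Suc (card I) mod 2 = q mod 2"
        using that assms nj fin[OF \<open>I \<subseteq> K'\<close>] by (auto simp: homogeneous_iff)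
      then have "even (card I) \<longleftrightarrow> odd q"
        by presburger
      then show ?thesis
        by (simp add: minus_one_power_iff)
    qed
    then show "gsign I (insert j J) * s I * coeff y (insert j I) = gsign I J * - ((-1) ^ q) * coeff y (insert j I)"
      using * by (cases "coeff y (insert j I) = 0") simp_all
  qed
  have ss: "s I * s I = 1" for I
    by (simp add: s_def flip: power_add)
  have split: "(\<Sum>I\<in>Pow (insert j K'). F I) = (\<Sum>I\<in>Pow K'. F I) + (\<Sum>I\<in>Pow K'. F (insert j I))"
    for F :: "nat set \<Rightarrow> real"
  proof -
    have "inj_on (insert j) (Pow K')" "Pow K' \<inter> insert j ` Pow K' = {}"
      using K' by (auto simp: inj_on_def)
    then show ?thesis
      using K' unfolding Pow_insert by (subst sum.union_disjoint) (auto simp: sum.reindex)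
  qed
  have rhs: "coeff (dtheta j y * z + (-1) ^ q * (y * dtheta j z)) K = (\<Sum>I\<in>Pow K.
      gsign I (K - I) * (coeff (dtheta j y) I * coeff z (K - I) + (-1) ^ q * (coeff y I * coeff (dtheta j z) (K - I))))"
    unfolding coeff_simps coeff_uminus_one_power_mult unfolding coeff_mult
    by (simp add: sum_distrib_left algebra_simps sum.distrib)
  show "coeff (dtheta j (y * z)) K = coeff (dtheta j y * z + (-1) ^ q * (y * dtheta j z)) K"
  proof (cases "j \<in> K")
    case True
    then have Ki: "K = insert j K'"
      by (auto simp: K'_def)
    have "coeff (dtheta j y * z + (-1) ^ q * (y * dtheta j z)) K = (\<Sum>I\<in>Pow K'.
       gsign I (insert j (K' - I)) * s I * coeff y (insert j I) * coeff z (insert j (K' - I)) +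
       (-1) ^ q * gsign (insert j I) (K' - I) * s (K' - I) * coeff y (insert j I) * coeff z (insert j (K' - I)))"
      unfolding rhs unfolding Ki split sum.distrib[symmetric]
    proof (rule sum.cong[OF refl])
      fix I assume "I \<in> Pow K'"
      then have "insert j K' - I = insert j (K' - I)" "insert j K' - insert j I = K' - I" "j \<notin> I"
        using K' by auto
      then show "gsign I (insert j K' - I) * (coeff (dtheta j y) I * coeff z (insert j K' - I) + (-1) ^ q * (coeff y I * coeff (dtheta j z) (insert j K' - I)))
        + gsign (insert j I) (insert j K' - insert j I) * (coeff (dtheta j y) (insert j I) * coeff z (insert j K' - insert j I) + (-1) ^ q * (coeff y (insert j I) * coeff (dtheta j z) (insert j K' - insert j I)))
        = gsign I (insert j (K' - I)) * s I * coeff y (insert j I) * coeff z (insert j (K' - I)) +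
       (-1) ^ q * gsign (insert j I) (K' - I) * s (K' - I) * coeff y (insert j I) * coeff z (insert j (K' - I))"
        using K' by (simp add: dtheta.rep_eq s_def)
    qed
    \<comment> \<open>By \<open>sgn2(2)\<close> the first summand carries the sign opposite to the
      one that \<open>sgn1\<close> gives for the second.\<close>
    also have "\<dots> = 0"
    proof (rule sum.neutral, rule ballI)
      fix I assume "I \<in> Pow K'"
      then show "gsign I (insert j (K' - I)) * s I * coeff y (insert j I) * coeff z (insert j (K' - I)) +
       (-1) ^ q * gsign (insert j I) (K' - I) * s (K' - I) * coeff y (insert j I) * coeff z (insert j (K' - I)) = 0"
        using sgn2(2)[of I "K' - I"] sgn1[of I "K' - I"] ss[of "K' - I"]
        by (simp add: mult.assoc)
    qed
    finally show ?thesis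
      using True by (simp add: dtheta.rep_eq)
  next
    case False
    then have Ki: "K' = K"
      by (auto simp: K'_def)
    have "coeff (dtheta j (y * z)) K = s K * (\<Sum>I\<in>Pow (insert j K'). gsign I (insert j K' - I) * coeff y I * coeff z (insert j K' - I))"
      using False by (simp add: dtheta.rep_eq s_def coeff_mult Ki)
    also have "\<dots> = (\<Sum>I\<in>Pow K'. s K * (gsign I (insert j K' - I) * coeff y I * coeff z (insert j K' - I)
        + gsign (insert j I) (insert j K' - insert j I) * coeff y (insert j I) * coeff z (insert j K' - insert j I)))"
      unfolding split sum.distrib[symmetric] by (simp add: sum_distrib_left)
    also have "\<dots> = coeff (dtheta j y * z + (-1) ^ q * (y * dtheta j z)) K"
      unfolding rhs unfolding Ki
    proof (rule sum.cong[OF refl])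
      fix I assume I: "I \<in> Pow K"
      have e: "insert j K - I = insert j (K - I)" "insert j K - insert j I = K - I" "j \<notin> I"
        using I False by auto
      have sK: "s K = s I * s (K - I)"
      proof -
        have "{i \<in> K. i < j} = {i \<in> I. i < j} \<union> {i \<in> K - I. i < j}"
          using I by auto
        moreover have "finite I" "finite (K - I)"
          using I K finite_subset by auto
        ultimately have "card {i \<in> K. i < j} = card {i \<in> I. i < j} + card {i \<in> K - I. i < j}"
          by (simp, subst card_Un_disjoint) auto
        then show ?thesis
          by (simp add: s_def power_add)
      qed
      have "s K * (gsign I (insert j (K - I)) * coeff y I) = s (K - I) * (gsign I (insert j (K - I)) * s I * coeff y I)"
        by (simp add: sK mult_ac)
      also have "\<dots> = s (K - I) * (gsign I (K - I) * (-1) ^ q * coeff y I)"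
        using sgn2(1)[of I "K - I"] I Ki by simp
      finally have *: "s K * (gsign I (insert j (K - I)) * coeff y I * c) = s (K - I) * (gsign I (K - I) * (-1) ^ q * coeff y I) * c" for c
        by (simp add: mult.assoc[symmetric])
      have "s K * gsign (insert j I) (K - I) = s I * gsign I (K - I) * (s (K - I) * s (K - I))"
        using sgn1[of I "K - I"] I Ki by (simp add: sK mult_ac)
      then have **: "s K * (gsign (insert j I) (K - I) * c * d) = s I * gsign I (K - I) * c * d" for c d
        by (simp add: ss mult.assoc[symmetric])
      have "coeff (dtheta j y) I = s I * coeff y (insert j I)"
        "coeff (dtheta j z) (K - I) = s (K - I) * coeff z (insert j (K - I))"
        using e False by (simp_all add: dtheta.rep_eq s_def)
      then show "s K * (gsign I (insert j K - I) * coeff y I * coeff z (insert j K - I)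
        + gsign (insert j I) (insert j K - insert j I) * coeff y (insert j I) * coeff z (insert j K - insert j I))
        = gsign I (K - I) * (coeff (dtheta j y) I * coeff z (K - I) + (-1) ^ q * (coeff y I * coeff (dtheta j z) (K - I)))"
        unfolding e(1,2) distrib_left[of "s K"] * ** by (simp add: algebra_simps)
    qed
    finally show ?thesis .
  qed
qed

subsection \<open>Power series in nilpotent elements\<close>

text \<open>The type has infinitely many generators, whereas \<open>gexp\<close>,
  \<open>gpowr\<close> and \<open>ginv\<close> break off after degree \<open>m\<close>. On the
  subalgebra of the first \<open>m\<close> generators this truncation loses nothing.\<close>

definition grassmann_in :: "nat \<Rightarrow> grassmann set" where
  "grassmann_in m = {z. \<forall>I. coeff z I \<noteq> 0 \<longrightarrow> I \<subseteq> {..<m}}"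

lemma grassmann_in_add: "y \<in> grassmann_in m \<Longrightarrow> z \<in> grassmann_in m \<Longrightarrow> y + z \<in> grassmann_in m"
  unfolding grassmann_in_def mem_Collect_eq coeff_simps by (metis add.right_neutral)

lemma grassmann_in_of_real [simp]: "of_real c \<in> grassmann_in m"
  by (auto simp: grassmann_in_def split: if_splits)

lemma grassmann_in_scaleR: "z \<in> grassmann_in m \<Longrightarrow> c *\<^sub>R z \<in> grassmann_in m"
  by (auto simp: grassmann_in_def)

lemma grassmann_in_soul: "z \<in> grassmann_in m \<Longrightarrow> soul z \<in> grassmann_in m"
  using grassmann_in_add[OF _ grassmann_in_of_real[of "- body z"]] by (simp add: soul_def)

lemma grassmann_in_mult:
  assumes "y \<in> grassmann_in m" "z \<in> grassmann_in m"
  shows "y * z \<in> grassmann_in m"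
  unfolding grassmann_in_def
proof (intro CollectI allI impI)
  fix K assume "coeff (y * z) K \<noteq> 0"
  then obtain I where "I \<subseteq> K" "coeff y I \<noteq> 0" "coeff z (K - I) \<noteq> 0"
    by (rule coeff_mult_nonzeroE)
  then show "K \<subseteq> {..<m}"
    using assms by (fastforce simp: grassmann_in_def)
qed

lemma grassmann_in_power: "z \<in> grassmann_in m \<Longrightarrow> z ^ k \<in> grassmann_in m"
  using grassmann_in_of_real[of 1] by (induction k) (auto intro: grassmann_in_mult)

lemma grassmann_in_sum: "(\<And>x. x \<in> A \<Longrightarrow> f x \<in> grassmann_in m) \<Longrightarrow> (\<Sum>x\<in>A. f x) \<in> grassmann_in m"
  using grassmann_in_of_real[of 0] by (induction A rule: infinite_finite_induct) (auto intro: grassmann_in_add)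

section \<open>Body and soul\<close>

lemma body_add: "body (y + z) = body y + body z"
  and body_diff: "body (y - z) = body y - body z"
  and body_of_real [simp]: "body (of_real c) = c"
  and body_scaleR [simp]: "body (c *\<^sub>R z) = c * body z"
  and body_mult [simp]: "body (y * z) = body y * body z"
  and body_1 [simp]: "body 1 = 1"
  by (simp_all add: body_def coeff_mult)

lemma body_power [simp]: "body (z ^ k) = body z ^ k"
  by (induction k) simp_all

lemma body_soul [simp]: "body (soul z) = 0"
  by (simp add: soul_def body_diff)

lemma body_plus_soul: "of_real (body z) + soul z = z"
  by (simp add: soul_def)

lemma body_sum: "body (\<Sum>x\<in>A. f x) = (\<Sum>x\<in>A. body (f x))"
  by (simp add: body_def coeff_sum)

lemma soul_scaleR: "soul (c *\<^sub>R z) = c *\<^sub>R soul z"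
  by (simp add: soul_def scaleR_conv_of_real algebra_simps)

lemma homogeneous_soul: "homogeneous 0 z \<Longrightarrow> homogeneous 0 (soul z)"
  by (simp add: soul_def homogeneous_diff)

text \<open>Each factor of body zero contributes at least one generator, and different factors must
  contribute different ones.\<close>

lemma coeff_power_low:
  assumes "body z = 0" "coeff (z ^ k) I \<noteq> 0"
  shows "k \<le> card I"
  using assms(2)
proof (induction k arbitrary: I)
  case (Suc k)
  from Suc.prems obtain J where J: "J \<subseteq> I" "coeff z J \<noteq> 0" "coeff (z ^ k) (I - J) \<noteq> 0" "finite I"
    unfolding power_Suc by (rule coeff_mult_nonzeroE)
  then have "J \<noteq> {}" "finite J"
    using assms(1) by (auto simp: body_def intro: finite_subset)
  then have "card J > 0"
    by auto
  moreover have "card I = card J + card (I - J)"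
    using J by (metis card_Diff_subset card_mono finite_subset le_add_diff_inverse)
  ultimately show ?case
    using Suc.IH[OF J(3)] by linarith
qed simp

text \<open>A monomial of the power would need at least \<open>k\<close> distinct generators, but
  only \<open>m < k\<close> are available.\<close>

lemma grassmann_nilpotent:
  assumes "body z = 0" "z \<in> grassmann_in m" "m < k"
  shows "z ^ k = 0"
proof (rule grassmann_eqI)
  fix I :: "nat set" assume "finite I"
  have False if nz: "coeff (z ^ k) I \<noteq> 0"
  proof -
    have "I \<subseteq> {..<m}"
      using nz grassmann_in_power[OF assms(2)] by (auto simp: grassmann_in_def)
    then have "card I \<le> m"
      using card_mono[of "{..<m}" I] by simp
    then show False
      using coeff_power_low[OF assms(1) nz] assms(3) by simp
  qed
  then show "coeff (z ^ k) I = coeff 0 I"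
    by auto
qed

section \<open>Truncated evaluation of formal power series\<close>

lemma power_scaleR: "(c *\<^sub>R z) ^ k = c ^ k *\<^sub>R (z :: 'a :: real_algebra_1) ^ k"
  by (induction k) simp_all

text \<open>Once \<open>gexp\<close> and \<open>gpowr\<close> are written through this evaluation,
  their functional equations are inherited from identities between formal power series.\<close>

definition fps_trunc_eval :: "nat \<Rightarrow> real fps \<Rightarrow> 'a :: real_algebra_1 \<Rightarrow> 'a" where
  "fps_trunc_eval m F z = (\<Sum>k\<le>m. fps_nth F k *\<^sub>R z ^ k)"

text \<open>Pairs of degrees with sum above \<open>m\<close> evaluate to zero. The remaining
  triangle of pairs, grouped by total degree, is the Cauchy product.\<close>

lemma fps_trunc_eval_mult:
  assumes "\<And>k. m < k \<Longrightarrow> z ^ k = 0"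
  shows "fps_trunc_eval m F z * fps_trunc_eval m G z = fps_trunc_eval m (F * G) z"
proof -
  have "fps_trunc_eval m F z * fps_trunc_eval m G z =
      (\<Sum>(k, l)\<in>{..m} \<times> {..m}. (fps_nth F k * fps_nth G l) *\<^sub>R z ^ (k + l))"
    by (simp add: fps_trunc_eval_def sum_product power_add sum.cartesian_product mult.commute)
  also have "\<dots> = (\<Sum>(k, l)\<in>{(k, l). k + l \<le> m}. (fps_nth F k * fps_nth G l) *\<^sub>R z ^ (k + l))"
  proof -
    have "k + l \<le> m" if "z ^ (k + l) \<noteq> 0" for k l
      using assms[of "k + l"] that by linarith
    then show ?thesis
      by (intro sum.mono_neutral_right) auto
  qed
  also have "\<dots> = (\<Sum>n\<le>m. \<Sum>k\<le>n. (fps_nth F k * fps_nth G (n - k)) *\<^sub>R z ^ (k + (n - k)))"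
    by (rule sum.triangle_reindex_eq)
  also have "\<dots> = fps_trunc_eval m (F * G) z"
    by (simp add: fps_trunc_eval_def fps_mult_nth scaleR_sum_left atMost_atLeast0)
  finally show ?thesis .
qed

lemma fps_trunc_eval_1 [simp]: "fps_trunc_eval m 1 z = 1"
proof -
  have "fps_trunc_eval m 1 z = (\<Sum>k\<in>{0}. fps_nth 1 k *\<^sub>R z ^ k)"
    unfolding fps_trunc_eval_def by (intro sum.mono_neutral_right) auto
  then show ?thesis
    by simp
qed

lemma gpowr_eq_fps: "gpowr m z r = (body z powr r) *\<^sub>R fps_trunc_eval m (fps_binomial r) ((1 / body z) *\<^sub>R soul z)"
  by (simp add: gpowr_def fps_trunc_eval_def)

lemma gexp_eq_fps: "gexp m z = exp (body z) *\<^sub>R fps_trunc_eval m (fps_exp 1) (soul z)"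
  by (simp add: gexp_def fps_trunc_eval_def)

text \<open>This is the formal identity \<open>(1 + X)^r (1 + X)^s = (1 + X)^(r + s)\<close>,
  evaluated at the soul divided by the body.\<close>

lemma gpowr_add:
  assumes "z \<in> grassmann_in m"
  shows "gpowr m z r * gpowr m z s = gpowr m z (r + s)"
proof -
  have "fps_trunc_eval m (fps_binomial r) ((1 / body z) *\<^sub>R soul z) *
      fps_trunc_eval m (fps_binomial s) ((1 / body z) *\<^sub>R soul z) =
      fps_trunc_eval m (fps_binomial (r + s)) ((1 / body z) *\<^sub>R soul z)"
    using assms
    by (subst fps_trunc_eval_mult)
      (auto simp: fps_binomial_add_mult intro!: grassmann_nilpotent grassmann_in_scaleR grassmann_in_soul)
  then show ?thesis
    by (simp add: gpowr_eq_fps powr_add)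
qed

lemma gpowr_0: "body z > 0 \<Longrightarrow> gpowr m z 0 = 1"
  by (simp add: gpowr_eq_fps)

lemma gpowr_1:
  assumes "z \<in> grassmann_in m" "body z > 0"
  shows "gpowr m z 1 = z"
proof -
  define w where "w = (1 / body z) *\<^sub>R soul z"
  have w: "w ^ k = 0" if "m < k" for k
    using that assms by (intro grassmann_nilpotent) (auto simp: w_def intro: grassmann_in_scaleR grassmann_in_soul)
  have g: "(1 :: real) gchoose k = (if k \<le> 1 then 1 else 0)" for k
    by (cases "k \<le> 1") (auto simp: le_Suc_eq gbinomial_eq_0 binomial_gbinomial[of 1 k, simplified, symmetric])
  have "(\<Sum>k\<le>m. (1 gchoose k) *\<^sub>R w ^ k) = (\<Sum>k\<in>{0, 1}. (1 gchoose k) *\<^sub>R w ^ k)"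
  proof -
    \<comment> \<open>Appending the vanishing term of degree \<open>m + 1\<close> brings the linear
      term into range even when \<open>m = 0\<close>.\<close>
    have "(\<Sum>k\<le>m. (1 gchoose k) *\<^sub>R w ^ k) = (\<Sum>k\<le>m + 1. (1 gchoose k) *\<^sub>R w ^ k)"
      using w[of "Suc m"] by simp
    also have "\<dots> = (\<Sum>k\<in>{0, 1}. (1 gchoose k) *\<^sub>R w ^ k)"
      by (intro sum.mono_neutral_right) (auto simp: g)
    finally show ?thesis .
  qed
  then have "gpowr m z 1 = body z *\<^sub>R (1 + w)"
    using assms(2) by (simp add: gpowr_def w_def)
  also have "\<dots> = of_real (body z) + soul z"
    using assms(2) by (simp add: w_def scaleR_add_right of_real_def)
  finally show ?thesis
    by (simp add: body_plus_soul)
qed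

text \<open>The geometric series is the binomial series of exponent -1. The inverse in the
  divergence thereby becomes subject to \<open>gpowr_add\<close>.\<close>

lemma ginv_eq_gpowr:
  assumes "body z > 0"
  shows "ginv m z = gpowr m z (- 1)"
proof -
  have "((- 1 :: real) gchoose k) = (- 1) ^ k" for k
    using gbinomial_minus[of "1 :: real" k] by (simp flip: binomial_gbinomial)
  moreover have "((- 1 / body z) *\<^sub>R soul z) ^ k = (- 1) ^ k *\<^sub>R ((1 / body z) *\<^sub>R soul z) ^ k" for k
    using power_mult_distrib[of "- 1" "1 / body z" k] by (simp add: power_scaleR power_divide del: scaleR_minus_left)
  ultimately show ?thesis
    using assms by (simp add: ginv_def gpowr_def powr_minus_divide)
qed

text \<open>The factor 1/2 is moved from the argument into the series, so that both factors are
  evaluations at the same nilpotent \<open>soul z\<close>; then \<open>fps_exp (1/2)\<close> squares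
  to \<open>fps_exp 1\<close>.\<close>

lemma gexp_half_mult:
  assumes "z \<in> grassmann_in m"
  shows "gexp m ((1/2) *\<^sub>R z) * gexp m ((1/2) *\<^sub>R z) = gexp m z"
proof -
  have half: "fps_trunc_eval m (fps_exp 1) ((1/2) *\<^sub>R soul z) = fps_trunc_eval m (fps_exp (1/2)) (soul z)"
    by (simp add: fps_trunc_eval_def power_divide power_scaleR mult.commute)
  have "fps_trunc_eval m (fps_exp (1/2)) (soul z) * fps_trunc_eval m (fps_exp (1/2)) (soul z) =
      fps_trunc_eval m (fps_exp 1) (soul z)"
    using assms
    by (subst fps_trunc_eval_mult)
      (auto simp flip: fps_exp_add_mult intro!: grassmann_nilpotent grassmann_in_soul)
  then show ?thesis
    by (simp add: gexp_eq_fps soul_scaleR half flip: exp_add)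
qed

lemma homogeneous_fps_trunc_eval: "homogeneous 0 z \<Longrightarrow> homogeneous 0 (fps_trunc_eval m F z)"
  by (auto simp: fps_trunc_eval_def intro!: homogeneous_sum homogeneous_scaleR homogeneous_0_power)

lemma homogeneous_gpowr: "homogeneous 0 z \<Longrightarrow> homogeneous 0 (gpowr m z r)"
  by (simp add: gpowr_eq_fps homogeneous_scaleR homogeneous_fps_trunc_eval homogeneous_soul)

lemma homogeneous_gexp: "homogeneous 0 z \<Longrightarrow> homogeneous 0 (gexp m z)"
  by (simp add: gexp_eq_fps homogeneous_scaleR homogeneous_fps_trunc_eval homogeneous_soul)

lemma body_fps_trunc_eval: "body z = 0 \<Longrightarrow> body (fps_trunc_eval m F z) = fps_nth F 0"
  by (simp add: fps_trunc_eval_def body_sum power_0_left if_distrib sum.delta' cong: if_cong)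

lemma body_gpowr: "body (gpowr m z r) = body z powr r"
  by (simp add: gpowr_eq_fps body_fps_trunc_eval)

lemma body_gexp: "body (gexp m z) = exp (body z)"
  by (simp add: gexp_eq_fps body_fps_trunc_eval)

lemma fps_trunc_eval_in: "z \<in> grassmann_in m \<Longrightarrow> fps_trunc_eval k F z \<in> grassmann_in m"
  by (auto simp: fps_trunc_eval_def intro!: grassmann_in_sum grassmann_in_scaleR grassmann_in_power)

lemma gpowr_in: "z \<in> grassmann_in m \<Longrightarrow> gpowr k z r \<in> grassmann_in m"
  by (simp add: gpowr_eq_fps grassmann_in_scaleR fps_trunc_eval_in grassmann_in_soul)

lemma gexp_in: "z \<in> grassmann_in m \<Longrightarrow> gexp k z \<in> grassmann_in m"
  by (simp add: gexp_eq_fps grassmann_in_scaleR fps_trunc_eval_in grassmann_in_soul)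

lemma ginv_mult:
  assumes "z \<in> grassmann_in m" "body z > 0"
  shows "ginv m z * z = 1"
  using gpowr_add[OF assms(1), of "- 1" 1] assms by (simp add: ginv_eq_gpowr gpowr_1 gpowr_0)

text \<open>As \<open>y\<close> commutes with \<open>z\<close>, the difference of the squares
  factors as \<open>(y + z) * (y - z)\<close>, and \<open>y + z\<close> is invertible because its
  body is positive.\<close>

lemma even_square_root_unique:
  assumes "y \<in> grassmann_in m" "z \<in> grassmann_in m" "homogeneous 0 y"
    and "body y > 0" "body z > 0" and "y * y = z * z"
  shows "y = z"
proof -
  have "(y + z) * (y - z) = 0"
    using even_commute[OF assms(3), of z] assms(6) by (simp add: algebra_simps)
  moreover have "ginv m (y + z) * (y + z) = 1"
    using assms by (intro ginv_mult grassmann_in_add) (auto simp: body_add)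
  ultimately have "y - z = 0"
    by (metis mult.assoc mult_1 mult_zero_right)
  then show ?thesis
    by simp
qed

section \<open>Differentiation of superfunctions\<close>

text \<open>\<open>pd\<close> is built on the total operator \<open>deriv\<close> and does not
  express that the derivative exists. This relation does so, for every coefficient; it concerns even
  coordinates only.\<close>

definition has_even_pd :: "superfun \<Rightarrow> grassmann \<Rightarrow> nat \<Rightarrow> (nat \<Rightarrow> real) \<Rightarrow> bool" where
  "has_even_pd f d a x \<longleftrightarrow>
     (\<forall>I. ((\<lambda>t. coeff (f (x(a := t))) I) has_real_derivative coeff d I) (at (x a)))"

lemma pd_eqI:
  assumes "has_even_pd f d a x" "a < n"
  shows "pd n a f x = d"
proof -
  have "pderiv_real a (\<lambda>y. coeff (f y) I) x = coeff d I" for I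
    using assms(1) by (auto simp: has_even_pd_def pderiv_real_def intro: DERIV_imp_deriv)
  then show ?thesis
    using assms(2) by (simp add: pd_def coeff_inverse)
qed

lemma has_even_pd_const: "has_even_pd (\<lambda>x. c) 0 a x"
  by (simp add: has_even_pd_def)

lemma has_even_pd_add:
  "has_even_pd f d a x \<Longrightarrow> has_even_pd g e a x \<Longrightarrow> has_even_pd (\<lambda>x. f x + g x) (d + e) a x"
  by (auto simp: has_even_pd_def intro!: derivative_eq_intros)

lemma has_even_pd_mult:
  assumes "has_even_pd f d a x" "has_even_pd g e a x"
  shows "has_even_pd (\<lambda>x. f x * g x) (d * g x + f x * e) a x"
  unfolding has_even_pd_def
proof
  fix K
  have "((\<lambda>t. \<Sum>I\<in>Pow K. gsign I (K - I) * coeff (f (x(a := t))) I * coeff (g (x(a := t))) (K - I))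
      has_real_derivative
      (\<Sum>I\<in>Pow K. gsign I (K - I) * coeff d I * coeff (g x) (K - I) +
        gsign I (K - I) * coeff (f x) I * coeff e (K - I))) (at (x a))"
    using assms unfolding has_even_pd_def
    by (intro DERIV_sum) (auto intro!: derivative_eq_intros simp: algebra_simps)
  then show "((\<lambda>t. coeff (f (x(a := t)) * g (x(a := t))) K)
      has_real_derivative coeff (d * g x + f x * e) K) (at (x a))"
    by (simp add: coeff_mult sum.distrib)
qed

text \<open>The weights \<open>w\<close> and the reindexing \<open>h\<close> do not depend on the
  point, so \<open>T\<close> commutes with differentiation along even coordinates. The cases of
  interest are \<open>dtheta\<close>, \<open>gpart\<close> and the projection to the body.\<close>

lemma has_even_pd_coeffwise:
  assumes "\<And>z I. coeff (T z) I = w I * coeff z (h I)" "has_even_pd f d a x"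
  shows "has_even_pd (\<lambda>x. T (f x)) (T d) a x"
  using assms(2) by (simp add: assms(1) has_even_pd_def DERIV_cmult)

lemma coeff_coeffwise:
  "coeff (dtheta j z) I = (if j \<in> I then 0 else (-1) ^ card {i \<in> I. i < j}) * coeff z (insert j I)"
  "coeff (gpart q z) I = (if card I mod 2 = q mod 2 then 1 else 0) * coeff z I"
  "coeff (of_real (body z)) I = (if I = {} then 1 else 0) * coeff z I"
  by (simp_all add: dtheta.rep_eq gpart.rep_eq body_def)

lemma has_even_pd_of_real_comp:
  assumes "has_even_pd f d a x" "(h has_real_derivative h') (at (body (f x)))"
  shows "has_even_pd (\<lambda>x. of_real (h (body (f x)))) (of_real h' * of_real (body d)) a x"
proof -
  have "((\<lambda>t. h (body (f (x(a := t))))) has_real_derivative h' * body d) (at (x a))"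
    using assms(1) DERIV_chain2[of h h' "\<lambda>t. body (f (x(a := t)))" "x a"] assms(2)
    by (simp add: has_even_pd_def body_def)
  then show ?thesis
    unfolding has_even_pd_def by (auto simp flip: of_real_mult)
qed

text \<open>Chart images are open in the space of sequences vanishing from \<open>n\<close> on, not
  in the space of all sequences. The condition retains what partial derivatives see of this: a short
  piece of each coordinate line through a point stays in \<open>V\<close>.\<close>

locale coordinate_open =
  fixes n :: nat and V :: "(nat \<Rightarrow> real) set"
  assumes line_open: "x \<in> V \<Longrightarrow> a < n \<Longrightarrow> eventually (\<lambda>t. x(a := t) \<in> V) (nhds (x a))"
begin

lemma has_even_pd_cong:
  assumes "\<And>y. y \<in> V \<Longrightarrow> f y = g y" "x \<in> V" "a < n"
  shows "has_even_pd f d a x \<longleftrightarrow> has_even_pd g d a x"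
proof -
  have "eventually (\<lambda>t. coeff (f (x(a := t))) I = coeff (g (x(a := t))) I) (nhds (x a))" for I
    using line_open[OF assms(2,3)] by (rule eventually_mono) (simp add: assms(1))
  then have "((\<lambda>t. coeff (f (x(a := t))) I) has_real_derivative coeff d I) (at (x a)) \<longleftrightarrow>
      ((\<lambda>t. coeff (g (x(a := t))) I) has_real_derivative coeff d I) (at (x a))" for I
    by (intro DERIV_cong_ev refl)
  then show ?thesis
    by (simp add: has_even_pd_def)
qed

lemma pd_cong:
  assumes "\<And>y. y \<in> V \<Longrightarrow> f y = g y" "x \<in> V"
  shows "pd n a f x = pd n a g x"
proof (cases "a < n")
  case True
  have "eventually (\<lambda>t. coeff (f (x(a := t))) I = coeff (g (x(a := t))) I) (nhds (x a))" for I
    using line_open[OF assms(2) True] by (rule eventually_mono) (simp add: assms(1))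
  then have "pderiv_real a (\<lambda>y. coeff (f y) I) x = pderiv_real a (\<lambda>y. coeff (g y) I) x" for I
    unfolding pderiv_real_def by (intro deriv_cong_ev refl)
  then show ?thesis
    using True by (simp add: pd_def)
qed (simp add: pd_def assms)

text \<open>The counter \<open>k\<close> gives the closure properties an induction. Odd coordinates
  get no clause of their own: \<open>dtheta\<close> acts on coefficients with constant weights and
  preserves every level.\<close>

primrec sdiff :: "nat \<Rightarrow> superfun \<Rightarrow> bool" where
  "sdiff 0 f \<longleftrightarrow> True"
| "sdiff (Suc k) f \<longleftrightarrow> (\<forall>a<n. (\<forall>x\<in>V. has_even_pd f (pd n a f x) a x) \<and> sdiff k (pd n a f))"

lemma sdiff_cong: "(\<And>y. y \<in> V \<Longrightarrow> f y = g y) \<Longrightarrow> sdiff k f \<longleftrightarrow> sdiff k g"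
proof (induction k arbitrary: f g)
  case (Suc k)
  have eq: "pd n a f x = pd n a g x" if "x \<in> V" for a x
    using Suc.prems that by (rule pd_cong)
  have "sdiff k (pd n a f) \<longleftrightarrow> sdiff k (pd n a g)" for a
    using eq by (rule Suc.IH)
  moreover have "has_even_pd f (pd n a f x) a x \<longleftrightarrow> has_even_pd g (pd n a g x) a x" if "x \<in> V" "a < n" for a x
    using has_even_pd_cong[OF Suc.prems that] eq[OF that(1)] by simp
  ultimately show ?case
    by simp
qed simp

text \<open>A candidate \<open>d\<close> for the derivative replaces \<open>pd\<close>. It has to be
  correct only on \<open>V\<close>, since by \<open>sdiff_cong\<close> only values on
  \<open>V\<close> matter.\<close>

lemma sdiff_SucI:
  assumes "\<And>a x. a < n \<Longrightarrow> x \<in> V \<Longrightarrow> has_even_pd f (d a x) a x" "\<And>a. a < n \<Longrightarrow> sdiff k (d a)"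
  shows "sdiff (Suc k) f"
proof -
  have eq: "pd n a f x = d a x" if "a < n" "x \<in> V" for a x
    using assms(1)[OF that] that(1) by (rule pd_eqI)
  have "sdiff k (pd n a f) \<longleftrightarrow> sdiff k (d a)" if "a < n" for a
    using eq[OF that] by (rule sdiff_cong)
  with eq show ?thesis
    using assms by simp
qed

lemma sdiff_SucD: "sdiff (Suc k) f \<Longrightarrow> sdiff k f"
proof (induction k arbitrary: f)
  case (Suc k)
  have "sdiff k (pd n a f)" if "a < n" for a
    using iffD1[OF sdiff.simps(2) Suc.prems] that by (intro Suc.IH) blast
  then show ?case
    using Suc.prems by simp
qed simp

lemma has_even_pd: "sdiff (Suc k) f \<Longrightarrow> a < n \<Longrightarrow> x \<in> V \<Longrightarrow> has_even_pd f (pd n a f x) a x"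
  by simp

section \<open>Closure properties of iterated differentiability\<close>

lemma sdiff_const [simp]: "sdiff k (\<lambda>x. c)"
  by (induction k arbitrary: c) (auto intro!: sdiff_SucI[where d = "\<lambda>a x. 0"] has_even_pd_const simp del: sdiff.simps(2))

lemma sdiff_add: "sdiff k f \<Longrightarrow> sdiff k g \<Longrightarrow> sdiff k (\<lambda>x. f x + g x)"
proof (induction k arbitrary: f g)
  case (Suc k)
  show ?case
    by (rule sdiff_SucI[where d = "\<lambda>a x. pd n a f x + pd n a g x"])
      (use Suc in \<open>auto intro!: has_even_pd_add\<close>)
qed simp

lemma sdiff_sum: "(\<And>i. i \<in> A \<Longrightarrow> sdiff k (f i)) \<Longrightarrow> sdiff k (\<lambda>x. \<Sum>i\<in>A. f i x)"
  by (induction A rule: infinite_finite_induct) (auto intro: sdiff_add)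

lemma sdiff_mult: "sdiff k f \<Longrightarrow> sdiff k g \<Longrightarrow> sdiff k (\<lambda>x. f x * g x)"
proof (induction k arbitrary: f g)
  case (Suc k)
  \<comment> \<open>The product rule leaves one factor undifferentiated, and the induction
    hypothesis asks for that factor at level \<open>k\<close>.\<close>
  have "sdiff k f" "sdiff k g"
    using Suc.prems sdiff_SucD by blast+
  then show ?case
    by (intro sdiff_SucI[where d = "\<lambda>a x. pd n a f x * g x + f x * pd n a g x"])
      (use Suc in \<open>auto intro!: has_even_pd_mult sdiff_add\<close>)
qed simp

lemma sdiff_power: "sdiff k f \<Longrightarrow> sdiff k (\<lambda>x. f x ^ j)"
  by (induction j) (auto intro: sdiff_mult)

lemma sdiff_coeffwise:
  assumes "\<And>z I. coeff (T z) I = w I * coeff z (h I)"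
  shows "sdiff k f \<Longrightarrow> sdiff k (\<lambda>x. T (f x))"
proof (induction k arbitrary: f)
  case (Suc k)
  then show ?case
    by (intro sdiff_SucI[where d = "\<lambda>a x. T (pd n a f x)"])
      (auto intro!: has_even_pd_coeffwise[OF assms])
qed simp

lemmas sdiff_dtheta = sdiff_coeffwise[OF coeff_coeffwise(1)]
  and sdiff_gpart = sdiff_coeffwise[OF coeff_coeffwise(2)]
  and sdiff_body = sdiff_coeffwise[OF coeff_coeffwise(3)]

lemma sdiff_scaleR: "sdiff k f \<Longrightarrow> sdiff k (\<lambda>x. c *\<^sub>R f x)"
  unfolding scaleR_conv_of_real by (intro sdiff_mult sdiff_const)

lemma sdiff_soul: "sdiff k f \<Longrightarrow> sdiff k (\<lambda>x. soul (f x))"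
proof -
  assume f: "sdiff k f"
  have "(\<lambda>x. soul (f x)) = (\<lambda>x. f x + (-1) *\<^sub>R of_real (body (f x)))"
    by (simp add: soul_def)
  with f show ?thesis
    by (simp only: sdiff_add sdiff_scaleR sdiff_body)
qed

lemma sdiff_pd: "sdiff (Suc k) f \<Longrightarrow> sdiff k (pd n a f)"
proof (cases "a < n")
  case False
  moreover assume "sdiff (Suc k) f"
  ultimately show ?thesis
    using sdiff_dtheta[OF sdiff_SucD] by (simp add: pd_def[abs_def])
qed simp

lemma sdiff_exp: "sdiff k f \<Longrightarrow> sdiff k (\<lambda>x. of_real (exp (body (f x))))"
proof (induction k)
  case (Suc k)
  then have "sdiff k f"
    using sdiff_SucD by blast
  with Suc show ?case
    by (intro sdiff_SucI[where d = "\<lambda>a x. of_real (exp (body (f x))) * of_real (body (pd n a f x))"])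
      (auto intro!: has_even_pd_of_real_comp sdiff_mult sdiff_body DERIV_exp)
qed simp

text \<open>Differentiation lowers the exponent to \<open>r - 1\<close>, hence the induction is over
  all exponents at once.\<close>

lemma sdiff_powr:
  assumes "\<And>x. x \<in> V \<Longrightarrow> body (f x) > 0"
  shows "sdiff k f \<Longrightarrow> sdiff k (\<lambda>x. of_real (body (f x) powr r))"
proof (induction k arbitrary: r)
  case (Suc k)
  then have "sdiff k f"
    using sdiff_SucD by blast
  show ?case
  proof (rule sdiff_SucI[where d = "\<lambda>a x. of_real (r * body (f x) powr (r - 1)) * of_real (body (pd n a f x))"])
    fix a x assume "a < n" "x \<in> V"
    then show "has_even_pd (\<lambda>x. of_real (body (f x) powr r))
        (of_real (r * body (f x) powr (r - 1)) * of_real (body (pd n a f x))) a x"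
      by (intro has_even_pd_of_real_comp has_even_pd[OF Suc.prems] has_real_derivative_powr assms)
  next
    fix a assume "a < n"
    then show "sdiff k (\<lambda>x. of_real (r * body (f x) powr (r - 1)) * of_real (body (pd n a f x)))"
      unfolding of_real_mult using \<open>sdiff k f\<close> Suc.prems
      by (intro sdiff_mult sdiff_const sdiff_body Suc.IH) simp_all
  qed
qed simp

lemma sdiff_fps_trunc_eval: "sdiff k f \<Longrightarrow> sdiff k (\<lambda>x. fps_trunc_eval m F (f x))"
  unfolding fps_trunc_eval_def by (intro sdiff_sum sdiff_scaleR sdiff_power)

lemma sdiff_gexp:
  assumes "sdiff k f"
  shows "sdiff k (\<lambda>x. gexp m (f x))"
  unfolding gexp_eq_fps scaleR_conv_of_real[of "exp _"]
  using assms by (intro sdiff_mult sdiff_exp sdiff_fps_trunc_eval sdiff_soul)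

lemma sdiff_gpowr:
  assumes "\<And>x. x \<in> V \<Longrightarrow> body (f x) > 0" "sdiff k f"
  shows "sdiff k (\<lambda>x. gpowr m (f x) r)"
proof -
  \<comment> \<open>The scalar \<open>1 / body (f x)\<close> is rewritten as a real power so that
    \<open>sdiff_powr\<close> covers it. This is valid on \<open>V\<close>, where the body is
    positive.\<close>
  have eq: "gpowr m (f x) r = of_real (body (f x) powr r) *
      fps_trunc_eval m (fps_binomial r) (of_real (body (f x) powr (-1)) * soul (f x))" if "x \<in> V" for x
    using assms(1)[OF that] by (simp add: gpowr_eq_fps scaleR_conv_of_real powr_minus_divide)
  have "sdiff k (\<lambda>x. of_real (body (f x) powr r) *
      fps_trunc_eval m (fps_binomial r) (of_real (body (f x) powr (-1)) * soul (f x)))"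
    using assms by (intro sdiff_mult sdiff_powr sdiff_fps_trunc_eval sdiff_soul)
  then show ?thesis
    by (rule iffD2[OF sdiff_cong, rotated]) (rule eq)
qed

lemma smooth_on_space_imp_sdiff:
  "(\<And>I. smooth_on_space n V (\<lambda>x. coeff (f x) I)) \<Longrightarrow> sdiff k f"
proof (induction k arbitrary: f)
  case (Suc k)
  have coeff_pd: "coeff (pd n a f x) I = pderiv_real a (\<lambda>y. coeff (f y) I) x" if "a < n" for a x I
  proof -
    \<comment> \<open>\<open>Grassmann_inverse\<close> applies to families that vanish on infinite
      index sets.\<close>
    have "pderiv_real a (\<lambda>y. coeff (f y) J) x = 0" if "infinite J" for J
      using that by (simp add: pderiv_real_def)
    then show ?thesis
      using that by (simp add: pd_def Grassmann_inverse)
  qed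
  show ?case
    unfolding sdiff.simps
  proof (intro allI impI conjI ballI)
    fix a x assume a: "a < n" and x: "x \<in> V"
    show "has_even_pd f (pd n a f x) a x"
      unfolding has_even_pd_def coeff_pd[OF a]
    proof
      fix I
      have "(\<lambda>t. coeff (f (x(a := t))) I) differentiable at (x a)"
        using Suc.prems[of I] a x unfolding smooth_on_space_def
        by (auto dest!: spec[of _ "[]"])
      then show "((\<lambda>t. coeff (f (x(a := t))) I) has_real_derivative
          pderiv_real a (\<lambda>y. coeff (f y) I) x) (at (x a))"
        by (simp add: pderiv_real_def DERIV_deriv_iff_real_differentiable)
    qed
  next
    fix a assume a: "a < n"
    show "sdiff k (pd n a f)"
    proof (rule Suc.IH)
      fix I
      show "smooth_on_space n V (\<lambda>x. coeff (pd n a f x) I)"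
        unfolding coeff_pd[OF a] smooth_on_space_def
      proof (intro allI impI)
        fix l assume "set l \<subseteq> {..<n}"
        \<comment> \<open>\<open>foldr\<close> applies the last list entry first, so appending
          \<open>a\<close> makes it the innermost derivative.\<close>
        with a have "set (l @ [a]) \<subseteq> {..<n}"
          by simp
        note * = mp[OF spec[OF Suc.prems[of I, unfolded smooth_on_space_def], of "l @ [a]"] this]
        from * show "continuous_on V (foldr pderiv_real l (pderiv_real a (\<lambda>y. coeff (f y) I))) \<and>
            (\<forall>b<n. \<forall>x\<in>V. (\<lambda>t. foldr pderiv_real l (pderiv_real a (\<lambda>y. coeff (f y) I)) (x(b := t))) differentiable at (x b))"
          by simp
      qed
    qed
  qed
qed simp

lemma superfunctions_sdiff: "f \<in> superfunctions n m V \<Longrightarrow> sdiff k f"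
  by (simp add: superfunctions_def smooth_on_space_imp_sdiff)

subsection \<open>Rules for partial derivatives\<close>

lemma dtheta_add: "dtheta j (y + z) = dtheta j y + dtheta j z"
  by (rule grassmann_eqI) (simp add: coeff_coeffwise(1) algebra_simps)

lemma pd_add:
  assumes "sdiff (Suc k) f" "sdiff (Suc k) g" "x \<in> V"
  shows "pd n a (\<lambda>x. f x + g x) x = pd n a f x + pd n a g x"
proof (cases "a < n")
  case True
  then show ?thesis
    using assms by (intro pd_eqI has_even_pd_add has_even_pd)
qed (simp add: pd_def dtheta_add)

lemma pd_const: "pd n a (\<lambda>x. of_real c) x = 0"
proof (cases "a < n")
  case True
  then show ?thesis
    by (intro pd_eqI has_even_pd_const)
next
  case False
  then show ?thesis
    by (auto simp: pd_def coeff_coeffwise(1) intro!: grassmann_eqI)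
qed

text \<open>Along an even coordinate the sign is trivial; along an odd one this is
  \<open>dtheta_mult\<close> for the values at \<open>x\<close>, so the parity of \<open>f\<close>
  is required at that point alone.\<close>

lemma pd_mult:
  assumes "sdiff (Suc k) f" "sdiff (Suc k) g" "x \<in> V" "homogeneous q (f x)"
  shows "pd n a (\<lambda>x. f x * g x) x = pd n a f x * g x + (-1) ^ (par n a * q) * (f x * pd n a g x)"
proof (cases "a < n")
  case True
  then have "pd n a (\<lambda>x. f x * g x) x = pd n a f x * g x + f x * pd n a g x"
    using assms by (intro pd_eqI has_even_pd_mult has_even_pd)
  with True show ?thesis
    by (simp add: par_def)
qed (simp add: pd_def par_def dtheta_mult assms)

lemma pd_even_mult:
  assumes "sdiff (Suc k) f" "sdiff (Suc k) g" "x \<in> V" "homogeneous 0 (f x)"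
  shows "pd n a (\<lambda>x. f x * g x) x = pd n a f x * g x + f x * pd n a g x"
  using pd_mult[OF assms, of a] by simp

lemma pd_sign_mult:
  assumes "sdiff (Suc k) f" "x \<in> V"
  shows "pd n a (\<lambda>x. (-1) ^ q * f x) x = (-1) ^ q * pd n a f x"
proof -
  have e: "(of_real ((-1) ^ q) :: grassmann) = (-1) ^ q"
    by simp
  show ?thesis
    using pd_even_mult[where a = a and f = "\<lambda>x. of_real ((-1) ^ q)", OF sdiff_const assms homogeneous_of_real]
    unfolding pd_const unfolding e by simp
qed

lemma pd_sum:
  assumes "\<And>i. i \<in> A \<Longrightarrow> sdiff (Suc k) (f i)" "x \<in> V"
  shows "pd n a (\<lambda>x. \<Sum>i\<in>A. f i x) x = (\<Sum>i\<in>A. pd n a (f i) x)"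
  using assms(1)
proof (induction A rule: infinite_finite_induct)
  case (insert i A)
  then show ?case
    using pd_add[of k "f i" "\<lambda>x. \<Sum>i\<in>A. f i x" x a] sdiff_sum[of A "Suc k" f] assms(2)
    by (simp del: sdiff.simps)
qed (use pd_const[of a 0 x] in simp_all)

text \<open>An even derivative commutes with the projection \<open>gpart q\<close>; an odd one
  removes a single generator.\<close>

lemma homogeneous_pd:
  assumes "sdiff (Suc k) f" "\<And>y. y \<in> V \<Longrightarrow> homogeneous q (f y)" "x \<in> V"
  shows "homogeneous (q + par n a) (pd n a f x)"
proof (cases "a < n")
  case True
  have "pd n a f x = pd n a (\<lambda>y. gpart q (f y)) x"
    using assms by (intro pd_cong) (auto simp: homogeneous_def)
  also have "\<dots> = gpart q (pd n a f x)"
    using assms True by (intro pd_eqI has_even_pd_coeffwise[OF coeff_coeffwise(2)] has_even_pd)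
  finally show ?thesis
    using True by (simp add: homogeneous_def par_def)
next
  case False
  then show ?thesis
    using homogeneous_dtheta[OF assms(2)[OF assms(3)], of "a - n"] by (simp add: pd_def par_def)
qed

end

section \<open>The odd Laplace operator in a chart\<close>

text \<open>This is the operator written \<open>D\<close> in the overview, the Laplace operator of
  the coordinate volume element. It depends on the chart.\<close>

definition density_Laplace :: "nat \<Rightarrow> nat \<Rightarrow> (nat \<Rightarrow> nat \<Rightarrow> superfun) \<Rightarrow> superfun \<Rightarrow> superfun" where
  "density_Laplace n m S f x = (\<Sum>a<n + m. \<Sum>b<n + m. pd n a (\<lambda>y. S a b y * pd n b f y) x)"

text \<open>The body of \<open>odd_Laplace\<close> with the manifold stripped off, so that one chart
  can be treated by itself.\<close>

definition chart_Laplace ::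
  "nat \<Rightarrow> nat \<Rightarrow> (nat \<Rightarrow> nat \<Rightarrow> superfun) \<Rightarrow> superfun \<Rightarrow> superfun \<Rightarrow> superfun" where
  "chart_Laplace n m S \<rho> f x =
     (\<Sum>q<2. divergence n m \<rho> (q + 1) (ham_field n m S q (\<lambda>y. gpart q (f y))) x)"

lemma odd_Laplace_eq_chart:
  "odd_Laplace M S \<rho> f i x = chart_Laplace (evdim M) (odim M) (S i) (\<rho> i) (f i) x"
  by (simp add: odd_Laplace_def chart_Laplace_def Let_def)

lemma pd_coord: "pd n c (coord n a) x = (if c = a then 1 else 0)"
proof (cases "c < n")
  case True
  have "has_even_pd (coord n a) (if c = a then 1 else 0) c x"
    using True by (cases "a < n"; cases "c = a") (auto simp: has_even_pd_def coord_def intro!: derivative_eq_intros)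
  then show ?thesis
    using True by (rule pd_eqI)
next
  case False
  then show ?thesis
    by (intro grassmann_eqI) (auto simp: pd_def coord_def dtheta.rep_eq theta.rep_eq)
qed

text \<open>Differentiating a coordinate function leaves one term of the outer sum of the bracket.
  The signs \<open>(-1)^(q + 1)\<close>, \<open>-1\<close> and \<open>(-1)^(q (a + 1))\<close>, with
  \<open>a\<close> standing for its parity, combine to \<open>(-1)^(a q)\<close>.\<close>

lemma ham_field_eq:
  assumes "a < n + m"
  shows "ham_field n m S q f a x = (-1) ^ (par n a * q) * (\<Sum>b<n + m. S a b x * pd n b f x)"
proof -
  have "odd_bracket n m S q f (coord n a) x =
      - (\<Sum>c<n + m. if c = a then (-1) ^ (q * (par n a + 1)) * (\<Sum>b<n + m. S a b x * pd n b f x) else 0)"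
    unfolding odd_bracket_def pd_coord
    by (intro arg_cong[of _ _ uminus] sum.cong) (auto simp: sum_distrib_left mult.assoc)
  also have "\<dots> = - ((-1) ^ (q * (par n a + 1)) * (\<Sum>b<n + m. S a b x * pd n b f x))"
    using assms by simp
  finally show ?thesis
    by (cases "even q") (simp_all add: ham_field_def power_add mult.commute[of q])
qed

section \<open>Coordinate formulas for the Laplace operator\<close>

context coordinate_open
begin

text \<open>The Hamiltonian field has parity \<open>q + 1\<close>, so the sign in its divergence
  cancels the one from \<open>ham_field_eq\<close>. The result no longer mentions \<open>q\<close>,
  and the two parity parts of \<open>f\<close> recombine by linearity.\<close>

lemma chart_Laplace_eq:
  assumes "\<And>a b. a < n + m \<Longrightarrow> b < n + m \<Longrightarrow> sdiff 1 (S a b)" "sdiff 2 f" "sdiff 1 \<rho>" "x \<in> V"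
  shows "chart_Laplace n m S \<rho> f x =
    ginv m (\<rho> x) * (\<Sum>a<n + m. \<Sum>b<n + m. pd n a (\<lambda>y. \<rho> y * (S a b y * pd n b f y)) x)"
proof -
  have f: "sdiff (Suc (Suc 0)) f" and f': "sdiff (Suc 0) f"
    using assms(2) sdiff_SucD[of "Suc 0" f] by (simp_all only: numeral_2_eq_2)
  have g: "sdiff (Suc 0) (pd n b (\<lambda>y. gpart q (f y)))" for b q
    by (intro sdiff_pd sdiff_gpart f)
  have sd: "sdiff (Suc 0) (\<lambda>y. \<rho> y * (S a b y * pd n b h y))"
    if "a < n + m" "b < n + m" "sdiff (Suc (Suc 0)) h" for a b h
    using assms that by (intro sdiff_mult sdiff_pd) (auto simp only: One_nat_def)
  have "(-1) ^ (par n a * (q + 1 + 1)) * pd n a (\<lambda>y. \<rho> y * ham_field n m S q (\<lambda>y. gpart q (f y)) a y) x =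
      (\<Sum>b<n + m. pd n a (\<lambda>y. \<rho> y * (S a b y * pd n b (\<lambda>y. gpart q (f y)) y)) x)" if a: "a < n + m" for a q
  proof -
    have "\<rho> y * ((-1) ^ k * z) = (-1) ^ k * (\<rho> y * z)" for y k z
      by (cases "even k") simp_all
    then have "pd n a (\<lambda>y. \<rho> y * ham_field n m S q (\<lambda>y. gpart q (f y)) a y) x =
        pd n a (\<lambda>y. (-1) ^ (par n a * q) * (\<Sum>b<n + m. \<rho> y * (S a b y * pd n b (\<lambda>y. gpart q (f y)) y))) x"
      by (simp add: ham_field_eq[OF a] sum_distrib_left)
    also have "\<dots> = (-1) ^ (par n a * q) * pd n a (\<lambda>y. \<Sum>b<n + m. \<rho> y * (S a b y * pd n b (\<lambda>y. gpart q (f y)) y)) x"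
      using a by (intro pd_sign_mult[of 0] sdiff_sum sd sdiff_gpart f assms) auto
    also have "pd n a (\<lambda>y. \<Sum>b<n + m. \<rho> y * (S a b y * pd n b (\<lambda>y. gpart q (f y)) y)) x =
        (\<Sum>b<n + m. pd n a (\<lambda>y. \<rho> y * (S a b y * pd n b (\<lambda>y. gpart q (f y)) y)) x)"
      using a by (intro pd_sum[of _ 0] sd sdiff_gpart f assms) auto
    finally show ?thesis
      by (simp add: mult.assoc[symmetric] flip: power_add) (simp add: algebra_simps flip: mult_2)
  qed
  then have "chart_Laplace n m S \<rho> f x =
      (\<Sum>q<2. ginv m (\<rho> x) * (\<Sum>a<n + m. \<Sum>b<n + m. pd n a (\<lambda>y. \<rho> y * (S a b y * pd n b (\<lambda>y. gpart q (f y)) y)) x))"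
    unfolding chart_Laplace_def divergence_def by (intro sum.cong arg_cong2[of _ _ _ _ "(*)"] refl) simp
  also have "\<dots> = ginv m (\<rho> x) * (\<Sum>a<n + m. \<Sum>b<n + m. \<Sum>q<2. pd n a (\<lambda>y. \<rho> y * (S a b y * pd n b (\<lambda>y. gpart q (f y)) y)) x)"
    by (simp add: eval_nat_numeral sum.distrib algebra_simps)
  also have "\<dots> = ginv m (\<rho> x) * (\<Sum>a<n + m. \<Sum>b<n + m. pd n a (\<lambda>y. \<rho> y * (S a b y * pd n b f y)) x)"
  proof (intro arg_cong2[of _ _ _ _ "(*)"] refl sum.cong)
    fix a b assume "a \<in> {..<n + m}" "b \<in> {..<n + m}"
    then have "(\<Sum>q<2. pd n a (\<lambda>y. \<rho> y * (S a b y * pd n b (\<lambda>y. gpart q (f y)) y)) x) =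
        pd n a (\<lambda>y. \<Sum>q<2. \<rho> y * (S a b y * pd n b (\<lambda>y. gpart q (f y)) y)) x"
      by (intro pd_sum[of _ 0, symmetric] sd sdiff_gpart f assms) auto
    also have "\<dots> = pd n a (\<lambda>y. \<rho> y * (S a b y * pd n b f y)) x"
    proof (rule pd_cong[OF _ assms(4)])
      fix y assume y: "y \<in> V"
      have "pd n b f y = pd n b (\<lambda>y. \<Sum>q<2. gpart q (f y)) y"
        by (simp add: eval_nat_numeral gpart_sum)
      also have "\<dots> = (\<Sum>q<2. pd n b (\<lambda>y. gpart q (f y)) y)"
        using y by (intro pd_sum[of _ 0] sdiff_gpart f')
      finally show "(\<Sum>q<2. \<rho> y * (S a b y * pd n b (\<lambda>y. gpart q (f y)) y)) = \<rho> y * (S a b y * pd n b f y)"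
        by (simp add: sum_distrib_left)
    qed
    finally show "(\<Sum>q<2. pd n a (\<lambda>y. \<rho> y * (S a b y * pd n b (\<lambda>y. gpart q (f y)) y)) x) =
        pd n a (\<lambda>y. \<rho> y * (S a b y * pd n b f y)) x" .
  qed
  finally show ?thesis .
qed

text \<open>In the abbreviations of the proof, summed over \<open>a\<close> and \<open>b\<close>,
  the left side is \<open>r (2 C + r B)\<close>, while \<open>D (r f)\<close> is
  \<open>A f + C' + C + r B\<close> and \<open>D r\<close> is \<open>A\<close>. The terms
  \<open>C\<close> and \<open>C'\<close> agree only after summation, because the graded symmetry of
  \<open>S\<close> exchanges the two indices.\<close>

lemma conjugated_Laplace:
  fixes S :: "nat \<Rightarrow> nat \<Rightarrow> superfun"
  assumes S: "\<And>a b. a < n + m \<Longrightarrow> b < n + m \<Longrightarrow> sdiff 1 (S a b)"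
    and S_par: "\<And>a b x. a < n + m \<Longrightarrow> b < n + m \<Longrightarrow> x \<in> V \<Longrightarrow> homogeneous (par n a + par n b + 1) (S a b x)"
    and S_sym: "\<And>a b x. a < n + m \<Longrightarrow> b < n + m \<Longrightarrow> x \<in> V \<Longrightarrow> S a b x = (-1) ^ (par n a * par n b) * S b a x"
    and r: "sdiff 2 r" "\<And>x. x \<in> V \<Longrightarrow> homogeneous 0 (r x)"
    and f: "sdiff 2 f" and x: "x \<in> V"
  shows "(\<Sum>a<n + m. \<Sum>b<n + m. pd n a (\<lambda>y. r y * r y * (S a b y * pd n b f y)) x) =
    r x * (density_Laplace n m S (\<lambda>y. r y * f y) x - density_Laplace n m S r x * f x)"
proof -
  have r2: "sdiff (Suc (Suc 0)) r" and r1: "sdiff (Suc 0) r"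
    and f2: "sdiff (Suc (Suc 0)) f" and f1: "sdiff (Suc 0) f"
    using r f sdiff_SucD[of "Suc 0"] by (simp_all only: numeral_2_eq_2)
  have S1: "sdiff (Suc 0) (S a b)" if "a < n + m" "b < n + m" for a b
    using S[OF that] by (simp only: One_nat_def)
  have cross: "(\<Sum>a<n + m. \<Sum>b<n + m. pd n a r x * (S a b x * pd n b f x)) =
      (\<Sum>a<n + m. \<Sum>b<n + m. S a b x * pd n b r x * pd n a f x)"
  proof -
    have "S b a x * pd n a r x = pd n a r x * S a b x" if "a < n + m" "b < n + m" for a b
    proof -
      have "homogeneous (par n a) (pd n a r x)"
        using homogeneous_pd[OF r1 r(2) x, of a] by simp
      then have "S b a x * pd n a r x = (-1) ^ ((par n b + par n a + 1) * par n a) * (pd n a r x * S b a x)"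
        using S_par[OF that(2,1) x] by (rule supercommute[rotated])
      \<comment> \<open>The two sign exponents differ by \<open>par n a * (par n a + 1)\<close>,
        which is even.\<close>
      also have "\<dots> = pd n a r x * ((-1) ^ (par n a * par n b) * S b a x)"
        by (auto simp: par_def)
      finally show ?thesis
        using S_sym[OF that x] by simp
    qed
    then have "(\<Sum>a<n + m. \<Sum>b<n + m. pd n a r x * (S a b x * pd n b f x)) =
        (\<Sum>a<n + m. \<Sum>b<n + m. S b a x * pd n a r x * pd n b f x)"
      by (intro sum.cong) (auto simp: mult.assoc)
    then show ?thesis
      by (subst (2) sum.swap)
  qed
  define A where "A a b = pd n a (\<lambda>y. S a b y * pd n b r y) x" for a b
  define B where "B a b = pd n a (\<lambda>y. S a b y * pd n b f y) x" for a b
  define C where "C a b = pd n a r x * (S a b x * pd n b f x)" for a b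
  define C' where "C' a b = S a b x * pd n b r x * pd n a f x" for a b
  have c: "r y * z = z * r y" if "y \<in> V" for y z
    using even_commute[OF r(2)[OF that]] .
  have 1: "pd n a (\<lambda>y. r y * r y * (S a b y * pd n b f y)) x = r x * (C a b + C a b + r x * B a b)"
    if "a < n + m" "b < n + m" for a b
  proof -
    have sd: "sdiff (Suc 0) (\<lambda>y. S a b y * pd n b f y)"
      by (intro sdiff_mult S1 that sdiff_pd f2)
    have "pd n a (\<lambda>y. r y * (r y * (S a b y * pd n b f y))) x =
        pd n a r x * (r x * (S a b x * pd n b f x)) + r x * pd n a (\<lambda>y. r y * (S a b y * pd n b f y)) x"
      by (intro pd_even_mult[OF r1 sdiff_mult[OF r1 sd] x r(2)[OF x]])
    also have "pd n a (\<lambda>y. r y * (S a b y * pd n b f y)) x = C a b + r x * B a b"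
      unfolding C_def B_def by (intro pd_even_mult[OF r1 sd x r(2)[OF x]])
    also have "pd n a r x * (r x * (S a b x * pd n b f x)) = r x * C a b"
      by (simp add: C_def c[OF x] mult.assoc)
    finally show ?thesis
      by (simp add: mult.assoc algebra_simps)
  qed
  have 2: "pd n a (\<lambda>y. S a b y * pd n b (\<lambda>y. r y * f y) y) x = A a b * f x + C' a b + C a b + r x * B a b"
    if "a < n + m" "b < n + m" for a b
  proof -
    have sd: "sdiff (Suc 0) (\<lambda>y. S a b y * pd n b f y)" "sdiff (Suc 0) (\<lambda>y. S a b y * pd n b r y)"
      by (intro sdiff_mult S1 that sdiff_pd f2 r2)+
    \<comment> \<open>The index \<open>b\<close> enters the parity twice and drops out. The Leibniz
      sign for moving the derivative along \<open>a\<close> past this factor is therefore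
      trivial.\<close>
    have hom: "homogeneous (par n a + 1) (S a b x * pd n b r x)"
    proof (rule homogeneous_mod)
      show "homogeneous (par n a + par n b + 1 + (0 + par n b)) (S a b x * pd n b r x)"
        by (intro homogeneous_mult S_par that x homogeneous_pd[OF r1 r(2)])
    qed (auto simp: par_def)
    have "pd n a (\<lambda>y. S a b y * pd n b (\<lambda>y. r y * f y) y) x =
        pd n a (\<lambda>y. S a b y * pd n b r y * f y + r y * (S a b y * pd n b f y)) x"
    proof (rule pd_cong[OF _ x])
      fix y assume y: "y \<in> V"
      have "pd n b (\<lambda>y. r y * f y) y = pd n b r y * f y + r y * pd n b f y"
        by (rule pd_even_mult[OF r1 f1 y r(2)[OF y]])
      then show "S a b y * pd n b (\<lambda>y. r y * f y) y = S a b y * pd n b r y * f y + r y * (S a b y * pd n b f y)"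
        by (simp add: distrib_left mult.assoc[symmetric] c[OF y, of "S a b y"])
    qed
    also have "\<dots> = pd n a (\<lambda>y. S a b y * pd n b r y * f y) x + pd n a (\<lambda>y. r y * (S a b y * pd n b f y)) x"
      by (intro pd_add[of 0] sdiff_mult[OF sd(2) f1] sdiff_mult[OF r1 sd(1)] x)
    also have "pd n a (\<lambda>y. r y * (S a b y * pd n b f y)) x = C a b + r x * B a b"
      unfolding C_def B_def by (intro pd_even_mult[OF r1 sd(1) x r(2)[OF x]])
    also have "pd n a (\<lambda>y. S a b y * pd n b r y * f y) x =
        A a b * f x + (-1) ^ (par n a * (par n a + 1)) * (S a b x * pd n b r x * pd n a f x)"
      unfolding A_def by (rule pd_mult[OF sd(2) f1 x hom])
    also have "(-1) ^ (par n a * (par n a + 1)) * (S a b x * pd n b r x * pd n a f x) = C' a b"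
      by (auto simp: C'_def par_def)
    finally show ?thesis
      by (simp add: add.assoc)
  qed
  have "(\<Sum>a<n + m. \<Sum>b<n + m. pd n a (\<lambda>y. r y * r y * (S a b y * pd n b f y)) x) =
      r x * ((\<Sum>a<n + m. \<Sum>b<n + m. C a b) + (\<Sum>a<n + m. \<Sum>b<n + m. C a b) + r x * (\<Sum>a<n + m. \<Sum>b<n + m. B a b))"
    by (simp add: 1 sum.distrib sum_distrib_left distrib_left)
  moreover have "density_Laplace n m S (\<lambda>y. r y * f y) x =
      (\<Sum>a<n + m. \<Sum>b<n + m. A a b) * f x + (\<Sum>a<n + m. \<Sum>b<n + m. C' a b) +
      (\<Sum>a<n + m. \<Sum>b<n + m. C a b) + r x * (\<Sum>a<n + m. \<Sum>b<n + m. B a b)"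
    by (simp add: density_Laplace_def 2 sum.distrib sum_distrib_left sum_distrib_right)
  moreover have "density_Laplace n m S r x = (\<Sum>a<n + m. \<Sum>b<n + m. A a b)"
    by (simp add: density_Laplace_def A_def)
  ultimately show ?thesis
    using cross by (simp add: C_def[symmetric] C'_def[symmetric])
qed

end

text \<open>\<open>V\<close> is cut out by an open set of the full product space, and changing a
  coordinate below \<open>n\<close> keeps the zero tail.\<close>

lemma openin_Euclidean_space_imp_coordinate_open:
  assumes "openin (Euclidean_space n) V"
  shows "coordinate_open n V"
proof
  fix x :: "nat \<Rightarrow> real" and a assume x: "x \<in> V" and a: "a < n"
  obtain U where U: "openin (powertop_real UNIV) U" "V = U \<inter> {x. \<forall>i\<ge>n. x i = 0}"
    using assms by (auto simp: Euclidean_space_def openin_subtopology)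
  have "continuous_map euclidean (powertop_real UNIV) (\<lambda>t. x(a := t))"
    by (auto simp: continuous_map_componentwise_UNIV fun_upd_def)
  then have "open ((\<lambda>t. x(a := t)) -` U)"
    using U(1) openin_continuous_map_preimage[of euclidean "powertop_real UNIV" "\<lambda>t. x(a := t)" U]
    by (simp add: vimage_def)
  moreover have "x a \<in> (\<lambda>t. x(a := t)) -` U"
    using x U(2) by simp
  ultimately have "eventually (\<lambda>t. t \<in> (\<lambda>t. x(a := t)) -` U) (nhds (x a))"
    by (rule eventually_nhds_in_open)
  then show "eventually (\<lambda>t. x(a := t) \<in> V) (nhds (x a))"
    by (rule eventually_mono) (use x a U(2) in auto)
qed

section \<open>The half-density operator in one chart\<close>

locale odd_Poisson_domain = coordinate_open +
  fixes m :: nat and S :: "nat \<Rightarrow> nat \<Rightarrow> superfun"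
  assumes sdiff_S: "a < n + m \<Longrightarrow> b < n + m \<Longrightarrow> sdiff 1 (S a b)"
    and homogeneous_S: "a < n + m \<Longrightarrow> b < n + m \<Longrightarrow> x \<in> V \<Longrightarrow> homogeneous (par n a + par n b + 1) (S a b x)"
    and S_sym: "a < n + m \<Longrightarrow> b < n + m \<Longrightarrow> x \<in> V \<Longrightarrow> S a b x = (-1) ^ (par n a * par n b) * S b a x"
begin

lemma density_Laplace_cong:
  assumes "\<And>y. y \<in> V \<Longrightarrow> f y = g y" "x \<in> V"
  shows "density_Laplace n m S f x = density_Laplace n m S g x"
  unfolding density_Laplace_def using assms
  by (intro sum.cong refl pd_cong arg_cong2[of _ _ _ _ "(*)"])

text \<open>The chart representative of a non-degenerate volume form, with the two derivatives that
  a second order operator takes of its square root.\<close>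

definition positive_density :: "superfun \<Rightarrow> bool" where
  "positive_density \<rho> \<longleftrightarrow> sdiff 2 \<rho> \<and>
     (\<forall>x\<in>V. \<rho> x \<in> grassmann_in m \<and> homogeneous 0 (\<rho> x) \<and> body (\<rho> x) > 0)"

lemma positive_density_gpowr:
  assumes "positive_density \<rho>"
  shows "positive_density (\<lambda>x. gpowr m (\<rho> x) r)"
proof -
  have "sdiff 2 (\<lambda>x. gpowr m (\<rho> x) r)"
    using assms by (intro sdiff_gpowr) (auto simp: positive_density_def simp del: sdiff.simps)
  then show ?thesis
    using assms by (auto simp: positive_density_def gpowr_in homogeneous_gpowr body_gpowr simp del: sdiff.simps)
qed

text \<open>This is \<open>conjugated_Laplace\<close> for the even square root of the density; the
  prefactor arises as the inverse of the density times that root.\<close>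

lemma chart_Laplace_eq_density_Laplace:
  assumes \<rho>: "positive_density \<rho>" and f: "sdiff 2 f" and x: "x \<in> V"
  shows "chart_Laplace n m S \<rho> f x = gpowr m (\<rho> x) (- 1/2) *
    (density_Laplace n m S (\<lambda>y. gpowr m (\<rho> y) (1/2) * f y) x -
      density_Laplace n m S (\<lambda>y. gpowr m (\<rho> y) (1/2)) x * f x)"
proof -
  define r where "r y = gpowr m (\<rho> y) (1/2)" for y
  have r: "sdiff 2 r" "\<And>y. y \<in> V \<Longrightarrow> homogeneous 0 (r y)"
    using positive_density_gpowr[OF \<rho>, of "1/2"] by (auto simp: positive_density_def r_def[abs_def])
  have rr: "\<rho> y = r y * r y" if "y \<in> V" for y
    using \<rho> that by (simp add: r_def gpowr_add gpowr_1 positive_density_def)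
  have \<rho>1: "sdiff 1 \<rho>"
    using \<rho> sdiff_SucD[of 1 \<rho>] by (simp add: positive_density_def numeral_2_eq_2 del: sdiff.simps)
  have "chart_Laplace n m S \<rho> f x =
      ginv m (\<rho> x) * (\<Sum>a<n + m. \<Sum>b<n + m. pd n a (\<lambda>y. \<rho> y * (S a b y * pd n b f y)) x)"
    by (rule chart_Laplace_eq[OF sdiff_S f \<rho>1 x])
  also have "(\<Sum>a<n + m. \<Sum>b<n + m. pd n a (\<lambda>y. \<rho> y * (S a b y * pd n b f y)) x) =
      (\<Sum>a<n + m. \<Sum>b<n + m. pd n a (\<lambda>y. r y * r y * (S a b y * pd n b f y)) x)"
    using x rr by (intro sum.cong refl pd_cong arg_cong2[of _ _ _ _ "(*)"])
  also have "\<dots> = r x * (density_Laplace n m S (\<lambda>y. r y * f y) x - density_Laplace n m S r x * f x)"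
    by (rule conjugated_Laplace[OF sdiff_S homogeneous_S S_sym r f x])
  finally have "chart_Laplace n m S \<rho> f x =
      ginv m (\<rho> x) * r x * (density_Laplace n m S (\<lambda>y. r y * f y) x - density_Laplace n m S r x * f x)"
    by (simp add: mult.assoc)
  moreover have "ginv m (\<rho> x) * r x = gpowr m (\<rho> x) (- 1/2)"
    using \<rho> x by (simp add: ginv_eq_gpowr r_def gpowr_add positive_density_def)
  ultimately show ?thesis
    by (simp add: r_def[abs_def])
qed

text \<open>Inserting \<open>f = s \<rho>^(-1/2)\<close> turns \<open>r f\<close> into
  \<open>s\<close>, since powers of the even density commute with everything. What is left is
  \<open>D\<close> minus a potential, and only the potential involves the volume form.\<close>

lemma half_density_Laplace_eq:
  assumes \<rho>: "positive_density \<rho>" and s: "sdiff 2 s" and x: "x \<in> V"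
  shows "gpowr m (\<rho> x) (1/2) * chart_Laplace n m S \<rho> (\<lambda>y. s y * gpowr m (\<rho> y) (- 1/2)) x =
    density_Laplace n m S s x -
      density_Laplace n m S (\<lambda>y. gpowr m (\<rho> y) (1/2)) x * gpowr m (\<rho> x) (- 1/2) * s x"
proof -
  have inv: "gpowr m (\<rho> y) (1/2) * gpowr m (\<rho> y) (- 1/2) = 1" if "y \<in> V" for y
    using \<rho> that by (simp add: gpowr_add gpowr_0 positive_density_def)
  have even: "gpowr m (\<rho> y) c * z = z * gpowr m (\<rho> y) c" if "y \<in> V" for y c z
    using \<rho> that by (intro even_commute homogeneous_gpowr) (simp add: positive_density_def)
  have f: "sdiff 2 (\<lambda>y. s y * gpowr m (\<rho> y) (- 1/2))"
    using s positive_density_gpowr[OF \<rho>] by (intro sdiff_mult) (auto simp: positive_density_def)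
  have "density_Laplace n m S (\<lambda>y. gpowr m (\<rho> y) (1/2) * (s y * gpowr m (\<rho> y) (- 1/2))) x =
      density_Laplace n m S s x"
  proof (rule density_Laplace_cong[OF _ x])
    fix y assume y: "y \<in> V"
    have "gpowr m (\<rho> y) (1/2) * (s y * gpowr m (\<rho> y) (- 1/2)) =
        s y * (gpowr m (\<rho> y) (1/2) * gpowr m (\<rho> y) (- 1/2))"
      by (simp only: mult.assoc[symmetric] even[OF y, of "1/2" "s y"])
    then show "gpowr m (\<rho> y) (1/2) * (s y * gpowr m (\<rho> y) (- 1/2)) = s y"
      by (simp only: inv[OF y] mult_1_right)
  qed
  then have "gpowr m (\<rho> x) (1/2) * chart_Laplace n m S \<rho> (\<lambda>y. s y * gpowr m (\<rho> y) (- 1/2)) x =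
      (gpowr m (\<rho> x) (1/2) * gpowr m (\<rho> x) (- 1/2)) * (density_Laplace n m S s x -
      density_Laplace n m S (\<lambda>y. gpowr m (\<rho> y) (1/2)) x * (s x * gpowr m (\<rho> x) (- 1/2)))"
    by (simp only: chart_Laplace_eq_density_Laplace[OF \<rho> f x] mult.assoc)
  then show ?thesis
    by (simp only: inv[OF x] mult_1_left mult.assoc even[OF x, of "- 1/2" "s x", symmetric])
qed

text \<open>Only the two potentials at \<open>x\<close> have to be compared. Harmonicity of
  \<open>E\<close> gives \<open>D r' = (D r) E\<close>, and this \<open>E\<close> is absorbed by the
  inverse root of \<open>\<rho>'\<close>.\<close>

lemma half_density_Laplace_invariant:
  assumes \<rho>: "positive_density \<rho>" and \<rho>': "positive_density \<rho>'"
    and \<sigma>: "sdiff 2 \<sigma>" "\<And>y. y \<in> V \<Longrightarrow> \<sigma> y \<in> grassmann_in m \<and> homogeneous 0 (\<sigma> y)"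
    and eq: "\<And>y. y \<in> V \<Longrightarrow> \<rho>' y = gexp m (\<sigma> y) * \<rho> y"
    and harmonic: "chart_Laplace n m S \<rho> (\<lambda>y. gexp m ((1/2) *\<^sub>R \<sigma> y)) x = 0"
    and s: "sdiff 2 s" and x: "x \<in> V"
  shows "gpowr m (\<rho> x) (1/2) * chart_Laplace n m S \<rho> (\<lambda>y. s y * gpowr m (\<rho> y) (- 1/2)) x =
    gpowr m (\<rho>' x) (1/2) * chart_Laplace n m S \<rho>' (\<lambda>y. s y * gpowr m (\<rho>' y) (- 1/2)) x"
proof -
  define E where "E y = gexp m ((1/2) *\<^sub>R \<sigma> y)" for y
  define r where "r y = gpowr m (\<rho> y) (1/2)" for y
  define r' where "r' y = gpowr m (\<rho>' y) (1/2)" for y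
  have E: "sdiff 2 E"
    unfolding E_def[abs_def] using \<sigma>(1) by (intro sdiff_gexp sdiff_scaleR)
  have E_even: "homogeneous 0 (E y)" "E y \<in> grassmann_in m" if "y \<in> V" for y
    using \<sigma>(2)[OF that] by (simp_all add: E_def homogeneous_gexp homogeneous_scaleR gexp_in grassmann_in_scaleR)
  have r_facts: "homogeneous 0 (r y)" "r y \<in> grassmann_in m" "body (r y) > 0"
    "homogeneous 0 (r' y)" "r' y \<in> grassmann_in m" "body (r' y) > 0"
    "r y * r y = \<rho> y" "r' y * r' y = \<rho>' y" if "y \<in> V" for y
    using positive_density_gpowr[OF \<rho>, of "1/2"] positive_density_gpowr[OF \<rho>', of "1/2"] \<rho> \<rho>' that
    by (simp_all add: positive_density_def r_def r'_def gpowr_add gpowr_1)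
  \<comment> \<open>Both sides are square roots of \<open>\<rho>'\<close> with positive body and
    \<open>r'\<close> is even, so uniqueness replaces a binomial expansion of a product.\<close>
  have r'_eq: "r' y = r y * E y" if y: "y \<in> V" for y
  proof (rule even_square_root_unique)
    show "r' y \<in> grassmann_in m" "r y * E y \<in> grassmann_in m" "homogeneous 0 (r' y)"
      "body (r' y) > 0" "body (r y * E y) > 0"
      using y r_facts E_even by (auto simp: grassmann_in_mult E_def body_gexp)
    have "r y * E y * (r y * E y) = r y * (E y * r y) * E y"
      by (simp only: mult.assoc)
    also have "\<dots> = (r y * r y) * (E y * E y)"
      by (simp only: even_commute[OF E_even(1)[OF y], of "r y"] mult.assoc)
    also have "\<dots> = \<rho> y * gexp m (\<sigma> y)"
      using y \<sigma>(2) by (simp add: r_facts(7) E_def gexp_half_mult)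
    also have "\<dots> = \<rho>' y"
      using y eq \<sigma>(2) by (simp add: even_commute[OF homogeneous_gexp])
    finally show "r' y * r' y = r y * E y * (r y * E y)"
      using r_facts(8)[OF y] by simp
  qed
  have inv: "r x * gpowr m (\<rho> x) (- 1/2) = 1" "gpowr m (\<rho>' x) (- 1/2) * r' x = 1"
    using \<rho> \<rho>' x by (simp_all add: r_def r'_def gpowr_add gpowr_0 positive_density_def)
  define X where "X = density_Laplace n m S (\<lambda>y. r y * E y) x - density_Laplace n m S r x * E x"
  have "gpowr m (\<rho> x) (- 1/2) * X = 0"
    using harmonic chart_Laplace_eq_density_Laplace[OF \<rho> E x] by (simp add: X_def r_def[abs_def] E_def[abs_def])
  \<comment> \<open>Multiplication by the root \<open>r\<close> strips the invertible prefactor and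
    isolates \<open>X\<close>.\<close>
  then have "r x * gpowr m (\<rho> x) (- 1/2) * X = 0"
    by (simp only: mult.assoc mult_zero_right)
  then have "density_Laplace n m S (\<lambda>y. r y * E y) x = density_Laplace n m S r x * E x"
    unfolding inv(1) by (simp add: X_def)
  then have D: "density_Laplace n m S r' x = density_Laplace n m S r x * E x"
    using density_Laplace_cong[of r' "\<lambda>y. r y * E y", OF _ x] r'_eq by simp
  \<comment> \<open>The product is kept in this order because it stands to the right of
    \<open>D r\<close> in the potential of \<open>\<rho>'\<close>.\<close>
  have "E x * gpowr m (\<rho>' x) (- 1/2) = gpowr m (\<rho> x) (- 1/2)"
  proof -
    have even: "gpowr m (\<rho>' x) (- 1/2) * z = z * gpowr m (\<rho>' x) (- 1/2)"
      "gpowr m (\<rho> x) (- 1/2) * z = z * gpowr m (\<rho> x) (- 1/2)" for z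
      using \<rho> \<rho>' x by (auto intro!: even_commute homogeneous_gpowr simp: positive_density_def)
    have "r x * E x * gpowr m (\<rho>' x) (- 1/2) = 1"
      using inv(2) unfolding even(1) r'_eq[OF x] .
    then have "gpowr m (\<rho> x) (- 1/2) = gpowr m (\<rho> x) (- 1/2) * (r x * E x * gpowr m (\<rho>' x) (- 1/2))"
      by (simp only: mult_1_right)
    also have "\<dots> = r x * gpowr m (\<rho> x) (- 1/2) * (E x * gpowr m (\<rho>' x) (- 1/2))"
      by (simp only: even(2)[of "r x"] mult.assoc[symmetric])
    finally show ?thesis
      unfolding inv(1) by simp
  qed
  then have "density_Laplace n m S r x * gpowr m (\<rho> x) (- 1/2) = density_Laplace n m S r' x * gpowr m (\<rho>' x) (- 1/2)"
    by (simp only: D mult.assoc)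
  then show ?thesis
    using half_density_Laplace_eq[OF \<rho> s x] half_density_Laplace_eq[OF \<rho>' s x]
    by (simp add: r_def[abs_def] r'_def[abs_def])
qed

end

section \<open>From a single chart to sections over the supermanifold\<close>

theorem corollary2p1:
  fixes M :: "('p, 'i) supermanifold"
    and S :: "'i \<Rightarrow> nat \<Rightarrow> nat \<Rightarrow> superfun"
    and \<rho> \<rho>' :: "'i local_family"
  assumes "is_supermanifold M" and "oriented M"
    and "odd_Poisson_structure M S"
    and "\<rho> \<in> nondeg_volume_forms M" and "\<rho>' \<in> nondeg_volume_forms M"
    and "same_orbit M S \<rho> \<rho>'"
  shows "\<forall>s\<in>half_densities M.
    section_eq M (odd_Laplace_half M S \<rho> s) (odd_Laplace_half M S \<rho>' s)"
  unfolding section_eq_def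
proof (intro ballI)
  fix s i x
  assume s: "s \<in> half_densities M" and i: "i \<in> charts M" and x: "x \<in> image_dom M i"
  let ?n = "evdim M" and ?m = "odim M" and ?V = "image_dom M i"
  obtain \<sigma> u where \<sigma>: "\<sigma> \<in> even_functions M"
    and u: "section_eq M u (\<lambda>i x. gexp ?m (\<sigma> i x))" "section_eq M \<rho>' (\<lambda>i x. u i x * \<rho> i x)"
    and harmonic: "section_eq M (odd_Laplace M S \<rho> (\<lambda>i x. gexp ?m ((1/2) *\<^sub>R \<sigma> i x))) (\<lambda>i x. 0)"
    using assms(6) unfolding same_orbit_def master_arrow_def by blast
  have "openin (Euclidean_space ?n) ?V"
    using assms(1) i unfolding is_supermanifold_def by blast
  then interpret coordinate_open ?n ?V
    by (rule openin_Euclidean_space_imp_coordinate_open)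
  have S: "S i a b \<in> superfunctions ?n ?m ?V"
    "y \<in> ?V \<Longrightarrow> homogeneous (par ?n a + par ?n b + 1) (S i a b y)"
    "y \<in> ?V \<Longrightarrow> S i a b y = (-1) ^ (par ?n a * par ?n b) * S i b a y"
    if "a < ?n + ?m" "b < ?n + ?m" for a b y
    using assms(3) i that unfolding odd_Poisson_structure_def Let_def by blast+
  interpret odd_Poisson_domain ?n ?V ?m "S i"
    by unfold_locales (fact superfunctions_sdiff[OF S(1)] S(2,3))+
  have in_grassmann: "f x \<in> grassmann_in ?m" if "f \<in> superfunctions ?n ?m ?V" "x \<in> ?V" for f x
    using that by (auto simp: superfunctions_def grassmann_in_def)
  have density: "positive_density (\<tau> i)" if "\<tau> \<in> nondeg_volume_forms M" for \<tau>
    using that i superfunctions_sdiff[of "\<tau> i" ?m 2] in_grassmann[of "\<tau> i"]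
    unfolding nondeg_volume_forms_def volume_forms_def local_smooth_def positive_density_def
    by (simp del: sdiff.simps)
  have \<sigma>_smooth: "\<sigma> i \<in> superfunctions ?n ?m ?V" and s_smooth: "s i \<in> superfunctions ?n ?m ?V"
    using \<sigma> s i by (simp_all add: even_functions_def global_functions_def half_densities_def local_smooth_def)
  \<comment> \<open>In chart \<open>i\<close> both operators are computed from the representatives
    in chart \<open>i\<close> alone, so equality of the resulting sections reduces to the invariance
    in one chart.\<close>
  have "gpowr ?m (\<rho> i x) (1/2) * chart_Laplace ?n ?m (S i) (\<rho> i) (\<lambda>y. s i y * gpowr ?m (\<rho> i y) (- 1/2)) x =
    gpowr ?m (\<rho>' i x) (1/2) * chart_Laplace ?n ?m (S i) (\<rho>' i) (\<lambda>y. s i y * gpowr ?m (\<rho>' i y) (- 1/2)) x"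
  proof (rule half_density_Laplace_invariant[OF density[OF assms(4)] density[OF assms(5)]])
    show "sdiff 2 (\<sigma> i)" "sdiff 2 (s i)"
      by (fact superfunctions_sdiff[OF \<sigma>_smooth] superfunctions_sdiff[OF s_smooth])+
    show "\<sigma> i y \<in> grassmann_in ?m \<and> homogeneous 0 (\<sigma> i y)" if "y \<in> ?V" for y
      using \<sigma> i that in_grassmann[OF \<sigma>_smooth that] by (simp add: even_functions_def)
    show "\<rho>' i y = gexp ?m (\<sigma> i y) * \<rho> i y" if "y \<in> ?V" for y
      using u i that by (simp add: section_eq_def)
    show "chart_Laplace ?n ?m (S i) (\<rho> i) (\<lambda>y. gexp ?m ((1/2) *\<^sub>R \<sigma> i y)) x = 0"
      using harmonic i x by (simp add: section_eq_def odd_Laplace_eq_chart)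
  qed (fact x)
  then show "odd_Laplace_half M S \<rho> s i x = odd_Laplace_half M S \<rho>' s i x"
    by (simp add: odd_Laplace_half_def odd_Laplace_eq_chart)
qed

end
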